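(* On a real nilpotent Lie algebra of dimension at most six, every Einstein metric is Ricci-flat.
   Context: A metric on a real Lie algebra $\mathfrak{g}$ is a non-degenerate symmetric bilinear form on $\mathfrak{g}$ of arbitrary signature; it is identified with the left-invariant pseudoriemannian metric it defines on a Lie group with Lie algebra $\mathfrak{g}$, and its Ricci tensor and Ricci operator $\operatorname{ric}\colon\mathfrak{g}\to\mathfrak{g}$ are those of that left-invariant metric. The metric is Einstein if $\operatorname{ric}=\lambda\,\mathrm{Id}$ for some $\lambda\in\mathbb{R}$, and Ricci-flat if $\operatorname{ric}=0$. *)

theory Defs
  imports "HOL-Analysis.Analysis"
begin

section \<open>Real Lie algebras\<close>

locale real_lie_algebra =
  fixes br :: "'a::real_vector \<Rightarrow> 'a \<Rightarrow> 'a"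
  assumes bilinear_br: "bilinear br"
    and br_self: "br x x = 0"
    and jacobi: "br x (br y z) + br y (br z x) + br z (br x y) = 0"

fun lower_central_series :: "('a::real_vector \<Rightarrow> 'a \<Rightarrow> 'a) \<Rightarrow> nat \<Rightarrow> 'a set" where
  "lower_central_series br 0 = UNIV"
| "lower_central_series br (Suc k) =
     span {br x y | x y. y \<in> lower_central_series br k}"

definition nilpotent_bracket :: "('a::real_vector \<Rightarrow> 'a \<Rightarrow> 'a) \<Rightarrow> bool" where
  "nilpotent_bracket br \<longleftrightarrow> (\<exists>k. lower_central_series br k = {0})"

section \<open>Metrics of arbitrary signature\<close>

locale metric_form =
  fixes g :: "'a::real_vector \<Rightarrow> 'a \<Rightarrow> real"
  assumes bilinear_g: "bilinear g"
    and sym_g: "g x y = g y x"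
    and nondegenerate_g: "(\<And>y. g x y = 0) \<Longrightarrow> x = 0"

section \<open>Curvature of a left-invariant metric\<close>

text \<open>
  Elements of the Lie algebra are left-invariant vector fields. For such fields the function
  \<open>g X Y\<close> is constant, so compatibility of the connection with the metric, namely
  \<open>Z (g X Y) = g (\<nabla> Z X) Y + g X (\<nabla> Z Y)\<close>, has left-hand side zero.
\<close>
definition is_levi_civita ::
  "('a::real_vector \<Rightarrow> 'a \<Rightarrow> 'a) \<Rightarrow> ('a \<Rightarrow> 'a \<Rightarrow> real) \<Rightarrow> ('a \<Rightarrow> 'a \<Rightarrow> 'a) \<Rightarrow> bool" where
  "is_levi_civita br g D \<longleftrightarrow>
     bilinear D \<and>
     (\<forall>x y. D x y - D y x = br x y) \<and>
     (\<forall>x y z. g (D z x) y + g x (D z y) = 0)"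

text \<open>
  Existence and uniqueness, for a metric on a finite-dimensional Lie algebra, is
  \<open>levi_civita_ex1\<close> below.
\<close>
definition levi_civita ::
  "('a::real_vector \<Rightarrow> 'a \<Rightarrow> 'a) \<Rightarrow> ('a \<Rightarrow> 'a \<Rightarrow> real) \<Rightarrow> 'a \<Rightarrow> 'a \<Rightarrow> 'a" where
  "levi_civita br g = (THE D. is_levi_civita br g D)"

definition riemann ::
  "('a::real_vector \<Rightarrow> 'a \<Rightarrow> 'a) \<Rightarrow> ('a \<Rightarrow> 'a \<Rightarrow> real) \<Rightarrow> 'a \<Rightarrow> 'a \<Rightarrow> 'a \<Rightarrow> 'a" where
  "riemann br g x y z =
     (let D = levi_civita br g in D x (D y z) - D y (D x z) - D (br x y) z)"

text \<open>
  Trace of an endomorphism of a finite-dimensional space; the basis chosen does not matter, see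
  \<open>linear_trace_eq\<close>.
\<close>
definition linear_trace :: "('a::real_vector \<Rightarrow> 'a) \<Rightarrow> real" where
  "linear_trace f =
     (let B = (SOME B. independent B \<and> span B = UNIV) in \<Sum>b\<in>B. representation B (f b) b)"

definition ricci_tensor ::
  "('a::real_vector \<Rightarrow> 'a \<Rightarrow> 'a) \<Rightarrow> ('a \<Rightarrow> 'a \<Rightarrow> real) \<Rightarrow> 'a \<Rightarrow> 'a \<Rightarrow> real" where
  "ricci_tensor br g y z = linear_trace (\<lambda>x. riemann br g x y z)"

text \<open>
  The endomorphism obtained from the Ricci tensor by raising an index; see
  \<open>ricci_operator_iff\<close>.
\<close>
definition ricci_operator ::
  "('a::real_vector \<Rightarrow> 'a \<Rightarrow> 'a) \<Rightarrow> ('a \<Rightarrow> 'a \<Rightarrow> real) \<Rightarrow> 'a \<Rightarrow> 'a" where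
  "ricci_operator br g x = (THE r. \<forall>y. g r y = ricci_tensor br g x y)"

definition einstein_metric ::
  "('a::real_vector \<Rightarrow> 'a \<Rightarrow> 'a) \<Rightarrow> ('a \<Rightarrow> 'a \<Rightarrow> real) \<Rightarrow> bool" where
  "einstein_metric br g \<longleftrightarrow> (\<exists>c::real. \<forall>x. ricci_operator br g x = c *\<^sub>R x)"

definition ricci_flat ::
  "('a::real_vector \<Rightarrow> 'a \<Rightarrow> 'a) \<Rightarrow> ('a \<Rightarrow> 'a \<Rightarrow> real) \<Rightarrow> bool" where
  "ricci_flat br g \<longleftrightarrow> (\<forall>x. ricci_operator br g x = 0)"

section \<open>The notions above are well defined\<close>

lemma basis_exists_finite:
  fixes S :: "'a::real_vector set"
  assumes "finite S" "span S = UNIV"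
  obtains B :: "'a set" where "independent B" "span B = UNIV" "finite B"
proof -
  obtain B where B: "B \<subseteq> S" "independent B" "S \<subseteq> span B"
    using real_vector.maximal_independent_subset[of S] by blast
  have "span B = UNIV"
    using B(3) assms(2) by (metis span_mono span_span top.extremum_uniqueI)
  then show ?thesis
    using that B assms(1) finite_subset by blast
qed

lemma finite_basis:
  fixes S B :: "'a::real_vector set"
  assumes "finite S" "span S = UNIV" "independent B"
  shows "finite B"
  using real_vector.independent_span_bound[OF assms(1,3)] assms(2) by simp

lemma linear_trace_basis_change:
  fixes f :: "'a::real_vector \<Rightarrow> 'a"
  assumes f: "linear f"
    and B: "independent B" "span B = UNIV" "finite B"
    and C: "independent C" "span C = UNIV" "finite C"
  shows "(\<Sum>b\<in>B. representation B (f b) b) = (\<Sum>c\<in>C. representation C (f c) c)"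
proof -
  have repsum: "representation A (\<Sum>i\<in>I. k i *\<^sub>R v i) a = (\<Sum>i\<in>I. k i * representation A (v i) a)"
    if A: "independent A" "span A = UNIV"
    for A and I :: "'a set" and k and v :: "'a \<Rightarrow> 'a" and a :: 'a
    using A by (simp add: real_vector.representation_sum real_vector.representation_scale)
  have eB: "(\<Sum>b\<in>B. representation B v b *\<^sub>R b) = v" for v
    using real_vector.sum_representation_eq[OF B(1) _ B(3)] B(2) by auto
  have eC: "(\<Sum>c\<in>C. representation C v c *\<^sub>R c) = v" for v
    using real_vector.sum_representation_eq[OF C(1) _ C(3)] C(2) by auto
  have "(\<Sum>b\<in>B. representation B (f b) b)
      = (\<Sum>b\<in>B. representation B (\<Sum>c\<in>C. representation C (f b) c *\<^sub>R c) b)"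
    by (simp add: eC)
  also have "\<dots> = (\<Sum>b\<in>B. \<Sum>c\<in>C. representation C (f b) c * representation B c b)"
    by (simp add: repsum[OF B(1,2)])
  also have "\<dots> = (\<Sum>c\<in>C. \<Sum>b\<in>B. representation B c b * representation C (f b) c)"
    by (subst sum.swap) (simp add: mult.commute)
  also have "\<dots> = (\<Sum>c\<in>C. representation C (\<Sum>b\<in>B. representation B c b *\<^sub>R f b) c)"
    by (simp add: repsum[OF C(1,2)])
  also have "\<dots> = (\<Sum>c\<in>C. representation C (f (\<Sum>b\<in>B. representation B c b *\<^sub>R b)) c)"
    using f by (simp add: linear_sum linear_cmul)
  also have "\<dots> = (\<Sum>c\<in>C. representation C (f c) c)"
    by (simp add: eB)
  finally show ?thesis .
qed

lemma linear_trace_eq: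
  fixes f :: "'a::real_vector \<Rightarrow> 'a"
  assumes f: "linear f" and C: "independent C" "span C = UNIV" "finite C"
  shows "linear_trace f = (\<Sum>c\<in>C. representation C (f c) c)"
proof -
  define B where "B = (SOME B::'a set. independent B \<and> span B = UNIV)"
  have B: "independent B \<and> span B = UNIV"
    unfolding B_def by (rule someI_ex) (use C in blast)
  then have "finite B"
    using finite_basis[OF C(3,2)] by blast
  then have "(\<Sum>b\<in>B. representation B (f b) b) = (\<Sum>c\<in>C. representation C (f c) c)"
    using linear_trace_basis_change[OF f] B C by blast
  then show ?thesis
    by (simp add: linear_trace_def B_def[symmetric] Let_def)
qed

context metric_form
begin

lemma linear_g_left: "linear (\<lambda>x. g x y)"
  using bilinear_g by (simp add: bilinear_def)

lemma linear_g_right: "linear (g x)"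
  using bilinear_g by (simp add: bilinear_def)

lemma g_add_left: "g (x + y) z = g x z + g y z"
  and g_diff_left: "g (x - y) z = g x z - g y z"
  and g_scale_left: "g (c *\<^sub>R x) z = c * g x z"
  and g_add_right: "g z (x + y) = g z x + g z y"
  and g_diff_right: "g z (x - y) = g z x - g z y"
  and g_scale_right: "g z (c *\<^sub>R x) = c * g z x"
  using linear_add[OF linear_g_left] linear_diff[OF linear_g_left] linear_scale[OF linear_g_left]
    linear_add[OF linear_g_right] linear_diff[OF linear_g_right] linear_scale[OF linear_g_right]
  by auto

lemma g_eqI: "(\<And>z. g x z = g y z) \<Longrightarrow> x = y"
  using nondegenerate_g[of "x - y"] by (simp add: g_diff_left)

lemma riesz_ex1:
  fixes \<phi> :: "'a \<Rightarrow> real"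
  assumes S: "finite S" "span S = (UNIV :: 'a set)" and \<phi>: "linear \<phi>"
  shows "\<exists>!r. \<forall>y. g r y = \<phi> y"
proof -
  obtain B :: "'a set" where B: "independent B" "span B = UNIV" "finite B"
    using basis_exists_finite[OF S] .
  interpret fd: finite_dimensional_vector_space "scaleR :: real \<Rightarrow> 'a \<Rightarrow> 'a" B
    by unfold_locales (use B in \<open>auto simp: dependent_raw_def span_raw_def\<close>)
  define T where "T x = (\<Sum>b\<in>B. g x b *\<^sub>R b)" for x
  have T: "linear T"
    by (rule linearI)
      (simp_all add: T_def g_add_left g_scale_left scaleR_left_distrib sum.distrib scaleR_sum_right)
  have eq_on_B: "\<psi> = \<psi>'"
    if "linear \<psi>" "linear \<psi>'" "\<And>b. b \<in> B \<Longrightarrow> \<psi> b = \<psi>' b" for \<psi> \<psi>' :: "'a \<Rightarrow> real"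
    using linear_eq_on_span[OF that(1,2), of B] that(3) B(2) by auto
  have coeffs: "k b = l b"
    if "(\<Sum>b\<in>B. k b *\<^sub>R b) = (\<Sum>b\<in>B. l b *\<^sub>R b)" "b \<in> B" for k l :: "'a \<Rightarrow> real" and b
  proof -
    have "(\<Sum>b\<in>B. (k b - l b) *\<^sub>R b) = 0"
      using that(1) by (simp add: scaleR_left_diff_distrib sum_subtractf)
    then show ?thesis
      using real_vector.independentD[OF B(1,3) order_refl _ that(2), of "\<lambda>b. k b - l b"] by simp
  qed
  have T_eq: "g x = \<psi>" if "linear \<psi>" "T x = (\<Sum>b\<in>B. \<psi> b *\<^sub>R b)" for x \<psi>
    using eq_on_B[OF linear_g_right that(1)] coeffs[of "g x" \<psi>] that(2) unfolding T_def by blast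
  have "inj T"
  proof (rule injI)
    fix x y assume "T x = T y"
    then have "g x = g y"
      by (intro T_eq linear_g_right) (simp add: T_def)
    then show "x = y"
      by (intro g_eqI) simp
  qed
  then have "surj T"
    using fd.linear_inj_imp_surj T by (simp add: linear_def)
  then obtain r where "T r = (\<Sum>b\<in>B. \<phi> b *\<^sub>R b)"
    by (metis surjD)
  then have "g r = \<phi>"
    using T_eq[OF \<phi>] by blast
  then show ?thesis
    by (intro ex1I[of _ r]) (auto intro: g_eqI)
qed

lemma is_levi_civita_koszul:
  assumes "is_levi_civita br g D"
  shows "2 * g (D x y) z = g (br x y) z - g (br y z) x + g (br z x) y"
proof -
  have t: "g (br u v) w = g (D u v) w - g (D v u) w" for u v w
    using assms by (simp add: is_levi_civita_def flip: g_diff_left)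
  have m: "g (D w u) v = - g (D w v) u" for u v w
    using assms sym_g[of u "D w v"] unfolding is_levi_civita_def by (metis add_eq_0_iff2)
  show ?thesis
    unfolding t using m[of z x y] m[of x y z] m[of y x z] by linarith
qed

lemma levi_civita_ex1:
  assumes "real_lie_algebra br" and S: "finite S" "span S = (UNIV :: 'a set)"
  shows "\<exists>!D. is_levi_civita br g D"
proof -
  interpret real_lie_algebra br by fact
  have br: "linear (br x)" "linear (\<lambda>x. br x y)" for x y
    using bilinear_br by (auto simp: bilinear_def)
  note br_simps = linear_add[OF br(1)] linear_add[OF br(2)] linear_scale[OF br(1)] linear_scale[OF br(2)]
  have anti: "br x y = - br y x" for x y
  proof -
    have "br (x + y) (x + y) = br x (x + y) + br y (x + y)"
      by (simp only: br_simps(2))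
    also have "\<dots> = br x y + br y x"
      by (simp add: br_simps(1) br_self)
    finally have "br x y + br y x = 0"
      by (simp only: br_self)
    then show ?thesis
      by (simp add: eq_neg_iff_add_eq_0)
  qed
  have g_minus: "g (- x) y = - g x y" for x y
    using g_scale_left[of "-1"] by simp
  define K where "K x y z = (g (br x y) z - g (br y z) x + g (br z x) y) / 2" for x y z
  have "linear (K x y)" for x y
    by (rule linearI)
      (simp_all add: K_def br_simps g_add_left g_add_right g_scale_left g_scale_right field_simps)
  then have "\<forall>x y. \<exists>r. \<forall>z. g r z = K x y z"
    using riesz_ex1[OF S] by blast
  then obtain D where D: "g (D x y) z = K x y z" for x y z
    by metis
  have "is_levi_civita br g D"
    unfolding is_levi_civita_def bilinear_def
  proof (intro conjI allI)
    show "linear (D x)" for x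
      by (intro linearI g_eqI)
        (simp_all add: D K_def br_simps g_add_left g_add_right g_scale_left g_scale_right field_simps)
    show "linear (\<lambda>x. D x y)" for y
      by (intro linearI g_eqI)
        (simp_all add: D K_def br_simps g_add_left g_add_right g_scale_left g_scale_right field_simps)
    show "D x y - D y x = br x y" for x y
    proof (rule g_eqI)
      fix z
      show "g (D x y - D y x) z = g (br x y) z"
        using anti[of y x] anti[of x z] anti[of z y]
        by (simp add: g_diff_left D K_def g_minus field_simps)
    qed
    show "g (D z x) y + g x (D z y) = 0" for x y z
      using anti[of z x] anti[of y z] anti[of y x]
      by (simp add: sym_g[of x] D K_def g_minus field_simps)
  qed
  moreover have "E = D" if "is_levi_civita br g E" for E
    using is_levi_civita_koszul[OF that]
    by (intro ext g_eqI) (simp add: D K_def eq_divide_eq mult.commute)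
  ultimately show ?thesis
    by blast
qed

lemma is_levi_civita_levi_civita:
  assumes "real_lie_algebra br" "finite S" "span S = (UNIV :: 'a set)"
  shows "is_levi_civita br g (levi_civita br g)"
  unfolding levi_civita_def using levi_civita_ex1[OF assms] by (rule theI')

lemma linear_riemann:
  assumes "real_lie_algebra br" "finite S" "span S = (UNIV :: 'a set)"
  shows "linear (\<lambda>x. riemann br g x y z)" "linear (\<lambda>z. riemann br g x y z)"
proof -
  interpret real_lie_algebra br by fact
  have D: "linear (levi_civita br g x)" "linear (\<lambda>x. levi_civita br g x y)" for x y
    using is_levi_civita_levi_civita[OF assms] by (auto simp: is_levi_civita_def bilinear_def)
  have br: "linear (\<lambda>x. br x y)" for y
    using bilinear_br by (simp add: bilinear_def)
  note simps = linear_add[OF D(1)] linear_add[OF D(2)] linear_scale[OF D(1)] linear_scale[OF D(2)]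
    linear_add[OF br] linear_scale[OF br]
  show "linear (\<lambda>x. riemann br g x y z)" "linear (\<lambda>z. riemann br g x y z)"
    by (rule linearI; simp add: riemann_def Let_def simps algebra_simps)+
qed

lemma linear_ricci_tensor:
  assumes "real_lie_algebra br" and S: "finite S" "span S = (UNIV :: 'a set)"
  shows "linear (ricci_tensor br g x)"
proof -
  obtain B :: "'a set" where B: "independent B" "span B = UNIV" "finite B"
    using basis_exists_finite[OF S] .
  have r: "ricci_tensor br g x y = (\<Sum>b\<in>B. representation B (riemann br g b x y) b)" for y
    unfolding ricci_tensor_def by (rule linear_trace_eq[OF linear_riemann(1)[OF assms] B])
  note R = linear_riemann(2)[OF assms]
  show ?thesis
    by (rule linearI)
      (simp_all add: r linear_add[OF R] linear_scale[OF R] B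
        real_vector.representation_add real_vector.representation_scale sum.distrib sum_distrib_left)
qed

lemma ricci_operator_iff:
  assumes "real_lie_algebra br" "finite S" "span S = (UNIV :: 'a set)"
  shows "ricci_operator br g x = r \<longleftrightarrow> (\<forall>y. g r y = ricci_tensor br g x y)"
proof -
  have ex1: "\<exists>!r. \<forall>y. g r y = ricci_tensor br g x y"
    by (rule riesz_ex1[OF assms(2,3) linear_ricci_tensor[OF assms]])
  have "\<forall>y. g (ricci_operator br g x) y = ricci_tensor br g x y"
    unfolding ricci_operator_def by (rule theI'[OF ex1])
  then show ?thesis
    by (auto intro: g_eqI)
qed

end

end

theory Submission
  imports Defs
begin

text \<open>
  For nilpotent Lie algebras the traces of \<open>ad y\<close> and of \<open>ad y \<circ> ad z\<close> vanish, so the Ricci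
  tensor is an explicit quadratic expression in the structure constants, and its contraction with
  a derivation \<open>D\<close> is zero. If \<open>ric = c Id\<close>, this reads \<open>c tr D = 0\<close>, and it remains to find a
  derivation of nonzero trace on every nonzero nilpotent Lie algebra of dimension at most six; it
  will be a grading by nonnegative weights. Instead of the classification, take an abelian ideal
  \<open>B\<close> of maximal dimension. It is its own centralizer, so the quotient by \<open>B\<close> acts faithfully on
  \<open>B\<close> by strictly triangular matrices, and in dimension at most six either \<open>B\<close> has codimension at
  most two, or \<open>B\<close> has dimension and codimension three and the quotient acts as the Heisenberg
  algebra. In codimension at most one, give \<open>B\<close> weight one and a complement weight zero. In
  codimension two, \<open>B\<close> is a module of dimension at most four over the polynomials in two commuting
  nilpotent operators, and its weights follow from the dimensions of its radical filtration.
  In codimension three, suitable generators have weights 1, 2, 3, 4, 5, 7.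
\<close>

section \<open>Derivations and the Ricci tensor\<close>

context real_lie_algebra
begin

lemma linear_br_left: "linear (\<lambda>x. br x y)"
  using bilinear_br by (simp add: bilinear_def)

lemma linear_br_right: "linear (br x)"
  using bilinear_br by (simp add: bilinear_def)

lemma br_add_left: "br (x + y) z = br x z + br y z"
  and br_diff_left: "br (x - y) z = br x z - br y z"
  and br_minus_left: "br (- x) z = - br x z"
  and br_scale_left: "br (c *\<^sub>R x) z = c *\<^sub>R br x z"
  and br_zero_left: "br 0 z = 0"
  and br_add_right: "br z (x + y) = br z x + br z y"
  and br_diff_right: "br z (x - y) = br z x - br z y"
  and br_minus_right: "br z (- x) = - br z x"
  and br_scale_right: "br z (c *\<^sub>R x) = c *\<^sub>R br z x"
  and br_zero_right: "br z 0 = 0"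
  using linear_add[OF linear_br_left] linear_diff[OF linear_br_left] linear_neg[OF linear_br_left]
    linear_scale[OF linear_br_left] linear_0[OF linear_br_left]
    linear_add[OF linear_br_right] linear_diff[OF linear_br_right] linear_neg[OF linear_br_right]
    linear_scale[OF linear_br_right] linear_0[OF linear_br_right]
  by auto

lemmas br_simps = br_add_left br_diff_left br_minus_left br_scale_left br_zero_left
  br_add_right br_diff_right br_minus_right br_scale_right br_zero_right

lemma br_anti: "br x y = - br y x"
proof -
  have "br x y + br y x = br (x + y) (x + y)"
    unfolding br_add_left br_add_right by (simp add: br_self)
  then show ?thesis
    by (simp only: br_self eq_neg_iff_add_eq_0)
qed

lemma br_br: "br (br x y) z = br x (br y z) - br y (br x z)"
  using jacobi[of x y z] br_anti[of z x] br_anti[of "br x y" z]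
  by (simp add: br_simps algebra_simps add_eq_0_iff)

definition derivation :: "('a \<Rightarrow> 'a) \<Rightarrow> bool" where
  "derivation D \<longleftrightarrow> linear D \<and> (\<forall>x y. D (br x y) = br (D x) y + br x (D y))"

section \<open>Lower central series and traces of filtration-lowering maps\<close>

abbreviation lcs :: "nat \<Rightarrow> 'a set" where
  "lcs \<equiv> lower_central_series br"

lemma br_in_lcs_Suc: "y \<in> lcs k \<Longrightarrow> br x y \<in> lcs (Suc k)"
  by (auto intro!: span_base)

lemma subspace_lcs: "subspace (lcs k)"
  by (cases k) (auto simp: subspace_UNIV)

lemma lcs_decreasing: "lcs (Suc k) \<subseteq> lcs k"
proof (induction k)
  case (Suc k)
  then show ?case
    by (subst (1 2) lower_central_series.simps) (intro span_mono, blast)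
qed simp

end

text \<open>Induction on the length: extend a basis of \<open>L (Suc 0)\<close> to one of
  \<open>L 0\<close>. The added vectors are mapped into the span of the old ones, and the old ones
  are covered by the induction hypothesis for the shifted filtration.\<close>

lemma basis_adapted_to_filtration:
  fixes L :: "nat \<Rightarrow> 'a::real_vector set"
  assumes sub: "\<And>k. subspace (L k)" and dec: "\<And>k. L (Suc k) \<subseteq> L k" and fin: "L n = {0}"
  shows "\<exists>B. independent B \<and> span B = L 0 \<and>
    (\<forall>f. (\<forall>k. f ` L k \<subseteq> L (Suc k)) \<longrightarrow> (\<forall>b\<in>B. f b \<in> span (B - {b})))"
  using assms
proof (induction n arbitrary: L)
  case 0
  then show ?case
    by (intro exI[of _ "{}"]) (simp add: real_vector.independent_empty)
next
  case (Suc n)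
  obtain B where B: "independent B" "span B = L (Suc 0)"
    "\<And>f. (\<forall>k. f ` L (Suc k) \<subseteq> L (Suc (Suc k))) \<Longrightarrow> (\<forall>b\<in>B. f b \<in> span (B - {b}))"
    using Suc.IH[of "\<lambda>k. L (Suc k)"] Suc.prems by auto
  have "B \<subseteq> L 0"
    using B(2) Suc.prems(2)[of 0] span_superset[of B] by blast
  then obtain C where C: "B \<subseteq> C" "C \<subseteq> L 0" "independent C" "L 0 \<subseteq> span C"
    using real_vector.maximal_independent_subset_extend[of B "L 0"] B(1) by blast
  have "span C = L 0"
    using C Suc.prems(1)[of 0] by (simp add: span_minimal subset_antisym)
  moreover have "f c \<in> span (C - {c})" if f: "\<forall>k. f ` L k \<subseteq> L (Suc k)" and c: "c \<in> C" for f c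
  proof (cases "c \<in> B")
    case True
    then have "f c \<in> span (B - {c})"
      using B(3) f by blast
    then show ?thesis
      using C(1) span_mono[of "B - {c}" "C - {c}"] by blast
  next
    case False
    have "f c \<in> span B"
      using f c C(2) B(2) by blast
    then show ?thesis
      using False C(1) span_mono[of B "C - {c}"] by blast
  qed
  ultimately show ?case
    using C(3) by blast
qed

lemma linear_trace_filtration:
  fixes f :: "'a::real_vector \<Rightarrow> 'a"
  assumes S: "finite S" "span S = (UNIV :: 'a set)" and f: "linear f"
    and "\<And>k. subspace (L k)" "\<And>k. L (Suc k) \<subseteq> L k" "L 0 = UNIV" "L n = {0}"
    and fL: "\<And>k. f ` L k \<subseteq> L (Suc k)"
  shows "linear_trace f = 0"
proof -
  obtain B where B: "independent B" "span B = UNIV" "\<And>b. b \<in> B \<Longrightarrow> f b \<in> span (B - {b})"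
    using basis_adapted_to_filtration[of L n] assms by metis
  have fin: "finite B"
    using finite_basis[OF S B(1)] .
  have "representation B (f b) b = 0" if b: "b \<in> B" for b
  proof -
    have ind: "independent (B - {b})"
      using B(1) by (rule independent_mono) auto
    have "representation B (f b) = representation (B - {b}) (f b)"
      by (rule real_vector.representation_extend) (use B b in auto)
    then show ?thesis
      using real_vector.representation_ne_zero[of "B - {b}" "f b" b] by auto
  qed
  then show ?thesis
    using linear_trace_eq[OF f B(1,2) fin] by simp
qed

section \<open>Contractions with a pair of dual bases\<close>

locale metric_lie_algebra = real_lie_algebra br + metric_form g
  for br :: "'a::real_vector \<Rightarrow> 'a \<Rightarrow> 'a" and g +
  fixes E :: "'a set" and d :: "'a \<Rightarrow> 'a"
  assumes finite_E: "finite E" and independent_E: "independent E" and span_E: "span E = UNIV"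
    and dual: "\<And>b c. b \<in> E \<Longrightarrow> c \<in> E \<Longrightarrow> g b (d c) = (if b = c then 1 else 0)"
begin

lemma g_sum_left: "g (\<Sum>i\<in>I. v i) x = (\<Sum>i\<in>I. g (v i) x)"
  and g_sum_right: "g x (\<Sum>i\<in>I. v i) = (\<Sum>i\<in>I. g x (v i))"
  using linear_sum[OF linear_g_left] linear_sum[OF linear_g_right] by auto

lemma g_minus_left: "g (- x) y = - g x y"
  and g_minus_right: "g y (- x) = - g y x"
  using linear_neg[OF linear_g_left] linear_neg[OF linear_g_right] by auto

lemmas g_simps = g_add_left g_diff_left g_minus_left g_scale_left
  g_add_right g_diff_right g_minus_right g_scale_right

lemma representation_E: "representation E v b = g v (d b)" if "b \<in> E"
proof -
  have "v = (\<Sum>c\<in>E. representation E v c *\<^sub>R c)"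
    using real_vector.sum_representation_eq[OF independent_E _ finite_E order_refl, of v] span_E
    by simp
  then have "g v (d b) = g (\<Sum>c\<in>E. representation E v c *\<^sub>R c) (d b)"
    by simp
  also have "\<dots> = (\<Sum>c\<in>E. representation E v c * (if c = b then 1 else 0))"
    by (simp add: g_sum_left g_scale_left dual that)
  finally show ?thesis
    using that finite_E by (simp add: if_distrib cong: if_cong)
qed

lemma expand: "(\<Sum>b\<in>E. g x (d b) *\<^sub>R b) = x"
  using real_vector.sum_representation_eq[OF independent_E _ finite_E order_refl, of x] span_E
  by (simp add: representation_E)

lemma contract: "(\<Sum>b\<in>E. g x (d b) * g b y) = g x y"
  using arg_cong[OF expand, of "\<lambda>u. g u y" x] by (simp add: g_sum_left g_scale_left)

lemma trace_eq: "linear f \<Longrightarrow> linear_trace f = (\<Sum>b\<in>E. g (f b) (d b))"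
  using linear_trace_eq[OF _ independent_E span_E finite_E] representation_E by simp

text \<open>The sum of the tensors of \<open>b\<close> with \<open>d b\<close> is the inverse of the
  symmetric form \<open>g\<close>, hence symmetric. It replaces an orthonormal basis, so no signs
  from the signature appear.\<close>

lemma dual_swap:
  fixes h :: "'a \<Rightarrow> 'a \<Rightarrow> real"
  assumes "bilinear h"
  shows "(\<Sum>b\<in>E. h (d b) b) = (\<Sum>b\<in>E. h b (d b))"
proof -
  have l: "linear (\<lambda>x. h x y)" "linear (h y)" for y
    using assms by (auto simp: bilinear_def)
  have "(\<Sum>b\<in>E. h (d b) b) = (\<Sum>b\<in>E. h (\<Sum>c\<in>E. g (d b) (d c) *\<^sub>R c) b)"
    by (simp only: expand)
  also have "\<dots> = (\<Sum>b\<in>E. \<Sum>c\<in>E. g (d b) (d c) * h c b)"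
    by (simp add: linear_sum[OF l(1)] linear_scale[OF l(1)])
  also have "\<dots> = (\<Sum>c\<in>E. \<Sum>b\<in>E. g (d c) (d b) * h c b)"
    by (subst sum.swap) (simp add: sym_g)
  also have "\<dots> = (\<Sum>c\<in>E. h c (\<Sum>b\<in>E. g (d c) (d b) *\<^sub>R b))"
    by (simp add: linear_sum[OF l(2)] linear_scale[OF l(2)])
  finally show ?thesis
    by (simp only: expand)
qed

text \<open>For the bilinear forms of two endomorphisms this is the trace of their product.\<close>
definition pair :: "('a \<Rightarrow> 'a \<Rightarrow> real) \<Rightarrow> ('a \<Rightarrow> 'a \<Rightarrow> real) \<Rightarrow> real" where
  "pair p q = (\<Sum>b\<in>E. \<Sum>c\<in>E. p b (d c) * q c (d b))"

lemma pair_commute: "pair p q = pair q p"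
  unfolding pair_def by (subst sum.swap) (simp add: mult.commute)

lemma trace_comp: "(\<Sum>b\<in>E. g (f (h b)) (d b)) = pair (\<lambda>x. g (h x)) (\<lambda>x. g (f x))" if "linear f"
proof -
  have "g (f (h b)) (d b) = (\<Sum>c\<in>E. g (h b) (d c) * g (f c) (d b))" for b
    by (subst expand[of "h b", symmetric])
      (simp add: linear_sum[OF that] linear_scale[OF that] g_sum_left g_scale_left)
  then show ?thesis
    by (simp add: pair_def)
qed

text \<open>Passing to \<open>g\<close>-adjoints preserves the trace of a product; in the double
  sum, \<open>dual_swap\<close> turns round each of the two contractions once.\<close>

lemma pair_transpose:
  assumes p: "bilinear p" and q: "bilinear q"
  shows "pair (\<lambda>x y. p y x) (\<lambda>x y. q y x) = pair p q"
proof -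
  have l: "linear (\<lambda>x. p x y)" "linear (p y)" "linear (\<lambda>x. q x y)" "linear (q y)" for y
    using p q by (auto simp: bilinear_def)
  note s = linear_add[OF l(1)] linear_add[OF l(2)] linear_add[OF l(3)] linear_add[OF l(4)]
    linear_scale[OF l(1)] linear_scale[OF l(2)] linear_scale[OF l(3)] linear_scale[OF l(4)]
  have "pair (\<lambda>x y. p y x) (\<lambda>x y. q y x) = (\<Sum>b\<in>E. \<Sum>c\<in>E. p (d c) b * q (d b) c)"
    by (simp add: pair_def)
  also have "\<dots> = (\<Sum>b\<in>E. \<Sum>c\<in>E. p c b * q (d b) (d c))"
    by (intro sum.cong refl dual_swap[of "\<lambda>x y. p x _ * q _ y"])
      (auto simp: bilinear_def s algebra_simps intro!: linearI)
  also have "\<dots> = (\<Sum>c\<in>E. \<Sum>b\<in>E. p c b * q (d b) (d c))"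
    by (rule sum.swap)
  also have "\<dots> = (\<Sum>c\<in>E. \<Sum>b\<in>E. p c (d b) * q b (d c))"
    by (intro sum.cong refl dual_swap[of "\<lambda>x y. p _ y * q x _"])
      (auto simp: bilinear_def s algebra_simps intro!: linearI)
  finally show ?thesis
    by (simp add: pair_def)
qed


lemma pair_algebra:
  "pair (\<lambda>x y. p x y + p' x y) q = pair p q + pair p' q"
  "pair (\<lambda>x y. p x y - p' x y) q = pair p q - pair p' q"
  "pair (\<lambda>x y. - p x y) q = - pair p q"
  "pair (\<lambda>x y. p x y / k) q = pair p q / k"
  by (simp_all add: pair_def sum.distrib sum_subtractf sum_negf sum_divide_distrib algebra_simps)

lemma pair_algebra_right:
  "pair q (\<lambda>x y. p x y + p' x y) = pair q p + pair q p'"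
  "pair q (\<lambda>x y. p x y - p' x y) = pair q p - pair q p'"
  "pair q (\<lambda>x y. - p x y) = - pair q p"
  "pair q (\<lambda>x y. p x y / k) = pair q p / k"
  by (simp_all add: pair_commute[of q] pair_algebra)

definition ad_form :: "'a \<Rightarrow> 'a \<Rightarrow> 'a \<Rightarrow> real" where
  "ad_form y = (\<lambda>x w. g (br y x) w)"

text \<open>With \<open>g\<close> identifying the space and its dual, this is the form of the
  coadjoint action of \<open>x\<close> on \<open>y\<close>, as a function of \<open>x\<close>. It is
  skew in \<open>x\<close> and \<open>w\<close>.\<close>

definition coad_form :: "'a \<Rightarrow> 'a \<Rightarrow> 'a \<Rightarrow> real" where
  "coad_form y = (\<lambda>x w. g (br w x) y)"

lemmas form_simps = br_simps g_simps algebra_simps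

lemma bilinear_forms: "bilinear (ad_form y)" "bilinear (coad_form y)"
  "bilinear (\<lambda>x w. ad_form y w x)"
  by (auto simp: bilinear_def ad_form_def coad_form_def form_simps intro!: linearI)

text \<open>Transposing both arguments shows that the skew form \<open>coad_form z\<close> pairs to
  zero with the symmetric part of \<open>ad_form y\<close>.\<close>

lemma pair_ad_coad: "pair (ad_form y) (coad_form z) = - pair (\<lambda>x w. ad_form y w x) (coad_form z)"
proof -
  have "pair (ad_form y) (coad_form z) = pair (\<lambda>x w. ad_form y w x) (\<lambda>x w. coad_form z w x)"
    by (rule pair_transpose[symmetric]) (rule bilinear_forms)+
  moreover have "(\<lambda>x w. coad_form z w x) = (\<lambda>x w. - coad_form z x w)"
    unfolding coad_form_def by (intro ext) (metis br_anti g_minus_left)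
  ultimately show ?thesis
    by (simp add: pair_algebra_right)
qed

lemma pair_ad_adjoint:
  "pair (ad_form y) (\<lambda>x w. ad_form z w x) = (\<Sum>b\<in>E. g (br y b) (br z (d b)))"
  by (simp add: pair_def ad_form_def contract sym_g[of "br z _"])

lemma pair_coad:
  "pair (coad_form y) (coad_form z) = - (\<Sum>b\<in>E. \<Sum>c\<in>E. g (br b c) y * g (br (d b) (d c)) z)"
proof -
  have "pair (coad_form y) (coad_form z)
      = (\<Sum>b\<in>E. \<Sum>c\<in>E. g (br (d c) b) y * g (br (d b) c) z)"
    by (simp add: pair_def coad_form_def)
  also have "\<dots> = (\<Sum>b\<in>E. \<Sum>c\<in>E. g (br c b) y * g (br (d b) (d c)) z)"
    by (intro sum.cong refl dual_swap[of "\<lambda>x w. g (br x _) y * g (br (d _) w) z"])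
      (auto simp: bilinear_def form_simps intro!: linearI)
  also have "\<dots> = (\<Sum>b\<in>E. \<Sum>c\<in>E. - (g (br b c) y * g (br (d b) (d c)) z))"
    by (intro sum.cong refl) (metis br_anti g_minus_left mult_minus_left)
  finally show ?thesis
    by (simp add: sum_negf)
qed

end

section \<open>The Ricci tensor of a nilpotent metric Lie algebra\<close>

locale nilpotent_metric_lie_algebra = metric_lie_algebra +
  assumes nilpotent: "nilpotent_bracket br"
begin

abbreviation nabla :: "'a \<Rightarrow> 'a \<Rightarrow> 'a" where
  "nabla \<equiv> levi_civita br g"

text \<open>The fixed argument is the field being differentiated: this is the form of the covariant
  differential of \<open>y\<close>, not of the skew map \<open>nabla y\<close>.\<close>

definition nabla_form :: "'a \<Rightarrow> 'a \<Rightarrow> 'a \<Rightarrow> real" where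
  "nabla_form y = (\<lambda>x w. g (nabla x y) w)"

lemma is_lc: "is_levi_civita br g nabla"
  using is_levi_civita_levi_civita[OF real_lie_algebra_axioms finite_E span_E] .

lemma linear_nabla: "linear (nabla x)" "linear (\<lambda>x. nabla x y)"
  using is_lc by (auto simp: is_levi_civita_def bilinear_def)

lemma nabla_simps:
  "nabla (x + y) z = nabla x z + nabla y z" "nabla (x - y) z = nabla x z - nabla y z"
  "nabla (k *\<^sub>R x) z = k *\<^sub>R nabla x z"
  "nabla z (x + y) = nabla z x + nabla z y" "nabla z (x - y) = nabla z x - nabla z y"
  "nabla z (k *\<^sub>R x) = k *\<^sub>R nabla z x"
  using linear_nabla by (auto simp: linear_add linear_diff linear_scale
    linear_add[OF linear_nabla(2)] linear_diff[OF linear_nabla(2)] linear_scale[OF linear_nabla(2)])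

lemma nabla_torsion: "nabla x y = nabla y x + br x y"
  using is_lc unfolding is_levi_civita_def by (metis diff_add_cancel add.commute)

lemma nabla_skew: "g (nabla z x) y = - g (nabla z y) x"
  using is_lc sym_g[of x "nabla z y"] unfolding is_levi_civita_def by (metis add_eq_0_iff2)

lemma trace_filtration:
  assumes "linear f" "\<And>k. f ` lcs k \<subseteq> lcs (Suc k)"
  shows "(\<Sum>b\<in>E. g (f b) (d b)) = 0"
proof -
  obtain n where "lcs n = {0}"
    using nilpotent by (auto simp: nilpotent_bracket_def)
  then have "linear_trace f = 0"
    using linear_trace_filtration[of E f lcs n] finite_E span_E assms subspace_lcs lcs_decreasing
    by simp
  then show ?thesis
    using trace_eq[OF assms(1)] by simp
qed

lemma trace_ad: "(\<Sum>b\<in>E. g (br y b) (d b)) = 0"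
  by (rule trace_filtration[OF linear_br_right]) (use br_in_lcs_Suc in blast)

lemma killing_form: "pair (ad_form y) (ad_form z) = 0"
proof -
  have "linear (\<lambda>x. br z (br y x))"
    by (rule linearI) (simp_all add: br_simps)
  then have "(\<Sum>b\<in>E. g (br z (br y b)) (d b)) = 0"
    by (rule trace_filtration) (use br_in_lcs_Suc lcs_decreasing in blast)
  then show ?thesis
    unfolding ad_form_def by (subst trace_comp[OF linear_br_right, symmetric])
qed

text \<open>\<open>nabla w\<close> is skew for \<open>g\<close>, hence traceless, and by the torsion
  identity it differs from the map in question by the traceless \<open>br w\<close>. Thus
  left-invariant fields have divergence zero.\<close>

lemma trace_nabla: "(\<Sum>b\<in>E. g (nabla b w) (d b)) = 0"
proof -
  have "bilinear (\<lambda>x y. g (nabla w x) y)"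
    by (auto simp: bilinear_def nabla_simps form_simps intro!: linearI)
  from dual_swap[OF this]
  have "(\<Sum>b\<in>E. g (nabla w b) (d b)) = (\<Sum>b\<in>E. g (nabla w (d b)) b)"
    by simp
  also have "\<dots> = - (\<Sum>b\<in>E. g (nabla w b) (d b))"
    by (simp add: nabla_skew[of w "d _"] sum_negf)
  finally have "(\<Sum>b\<in>E. g (nabla w b) (d b)) = 0"
    by simp
  moreover have "g (nabla b w) (d b) = g (nabla w b) (d b) - g (br w b) (d b)" for b
    using nabla_torsion[of w b] by (simp add: g_simps)
  ultimately show ?thesis
    using trace_ad[of w] by (simp add: sum_subtractf)
qed

lemma ricci_eq_pair: "ricci_tensor br g y z = - pair (nabla_form y) (nabla_form z)"
proof -
  have lin: "linear (\<lambda>x. nabla x z)"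
    by (rule linear_nabla)
  \<comment> \<open>Both sides are traces of the same two maps composed in opposite orders.\<close>
  have t: "(\<Sum>b\<in>E. g (br y (nabla b z)) (d b)) = (\<Sum>b\<in>E. g (nabla (br y b) z) (d b))"
    using trace_comp[OF linear_br_right[of y], where h = "\<lambda>x. nabla x z"] trace_comp[OF lin, where h = "br y"]
      pair_commute by simp
  \<comment> \<open>Torsion-freeness rewrites \<open>nabla y (nabla x z)\<close>. In the trace over
    \<open>x\<close> the first term is then a divergence, the last two cancel by \<open>t\<close>,
    and a product of two covariant differentials remains.\<close>
  have "riemann br g x y z = nabla x (nabla y z) - nabla (nabla x z) y - br y (nabla x z)
      + nabla (br y x) z" for x
    using br_anti[of x y] nabla_torsion[of y "nabla x z"] linear_neg[OF lin, of "br y x"]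
    by (simp add: riemann_def Let_def)
  then have "ricci_tensor br g y z = (\<Sum>b\<in>E. g (nabla b (nabla y z)) (d b))
      - (\<Sum>b\<in>E. g (nabla (nabla b z) y) (d b)) - (\<Sum>b\<in>E. g (br y (nabla b z)) (d b))
      + (\<Sum>b\<in>E. g (nabla (br y b) z) (d b))"
    unfolding ricci_tensor_def
    using trace_eq[OF linear_riemann(1)[OF real_lie_algebra_axioms finite_E span_E], of y z]
    by (simp add: g_simps sum.distrib sum_subtractf)
  then show ?thesis
    using t trace_nabla trace_comp[OF linear_nabla(2)[of y], where h = "\<lambda>x. nabla x z"]
      pair_commute[of "nabla_form y"] by (simp add: nabla_form_def)
qed

text \<open>The Koszul formula, arranged as the skew form \<open>coad_form y\<close> minus the
  symmetrization of \<open>ad_form y\<close>.\<close>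

lemma nabla_form_eq:
  "nabla_form y = (\<lambda>x w. (coad_form y x w - ad_form y x w - ad_form y w x) / 2)"
proof (intro ext)
  fix x w
  show "nabla_form y x w = (coad_form y x w - ad_form y x w - ad_form y w x) / 2"
    using is_levi_civita_koszul[OF is_lc, of x y w] br_anti[of x y]
    by (simp add: nabla_form_def coad_form_def ad_form_def g_minus_left)
qed

text \<open>When two copies of \<open>nabla_form_eq\<close> are multiplied, the products of two
  \<open>ad\<close> terms that are both transposed or both not are Killing forms and vanish, and the
  mixed terms with \<open>coad_form\<close> cancel by \<open>pair_ad_coad\<close>. What remains is
  \<open>coad_form\<close> times \<open>coad_form\<close> and \<open>ad\<close> times its
  adjoint.\<close>

lemma ricci_eq:
  "ricci_tensor br g y z = (\<Sum>b\<in>E. \<Sum>c\<in>E. g (br b c) y * g (br (d b) (d c)) z) / 4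
    - (\<Sum>b\<in>E. g (br y b) (br z (d b))) / 2"
proof -
  have "pair (\<lambda>x w. ad_form y w x) (\<lambda>x w. ad_form z w x) = 0"
    using pair_transpose[OF bilinear_forms(1,1), of y z] killing_form by simp
  moreover have "pair (\<lambda>x w. ad_form y w x) (ad_form z) = pair (ad_form y) (\<lambda>x w. ad_form z w x)"
    using pair_transpose[OF bilinear_forms(1,3), of y z] by simp
  moreover have "pair (coad_form y) (ad_form z) = - pair (coad_form y) (\<lambda>x w. ad_form z w x)"
    using pair_ad_coad[of z y] by (simp add: pair_commute)
  ultimately show ?thesis
    unfolding ricci_eq_pair nabla_form_eq
    by (simp add: pair_algebra pair_algebra_right killing_form pair_ad_coad[of y z]
      pair_coad pair_ad_adjoint field_simps)
qed

text \<open>Contraction turns the first sum of \<open>ricci_eq\<close> into the pairing of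
  \<open>D (br (d b) (d c))\<close> with \<open>br b c\<close>. The Leibniz rule splits it into two
  equal halves, each equal to the contraction of the second sum, so the coefficients 1/4 and 1/2
  cancel.\<close>

lemma ricci_derivation:
  assumes D: "derivation D"
  shows "(\<Sum>j\<in>E. ricci_tensor br g (D j) (d j)) = 0"
proof -
  have linD: "linear D" and der: "\<And>x y. D (br x y) = br (D x) y + br x (D y)"
    using D by (auto simp: derivation_def)
  have "(\<Sum>j\<in>E. \<Sum>b\<in>E. \<Sum>c\<in>E. g (br b c) (D j) * g (br (d b) (d c)) (d j))
      = (\<Sum>b\<in>E. \<Sum>c\<in>E. \<Sum>j\<in>E. g (br (d b) (d c)) (d j) * g (D j) (br b c))"
    by (subst sum.swap, rule sum.cong[OF refl], subst sum.swap, simp add: mult.commute sym_g)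
  also have "\<dots> = (\<Sum>b\<in>E. \<Sum>c\<in>E. g (D (br (d b) (d c))) (br b c))"
  proof -
    have "(\<Sum>j\<in>E. g u (d j) * g (D j) v) = g (D u) v" for u v
      by (subst (2) expand[of u, symmetric])
        (simp add: linear_sum[OF linD] linear_scale[OF linD] g_sum_left g_scale_left)
    then show ?thesis
      by simp
  qed
  also have "\<dots> = (\<Sum>b\<in>E. \<Sum>c\<in>E. g (br (D (d b)) (d c)) (br b c))
      + (\<Sum>b\<in>E. \<Sum>c\<in>E. g (br (d b) (D (d c))) (br b c))"
    by (simp add: der g_simps sum.distrib)
  also have "(\<Sum>b\<in>E. \<Sum>c\<in>E. g (br (d b) (D (d c))) (br b c))
      = (\<Sum>b\<in>E. \<Sum>c\<in>E. g (br (D (d b)) (d c)) (br b c))"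
    by (subst sum.swap, intro sum.cong refl, subst (1 2) br_anti) (simp add: g_simps)
  also have "(\<Sum>b\<in>E. \<Sum>c\<in>E. g (br (D (d b)) (d c)) (br b c))
      = (\<Sum>b\<in>E. \<Sum>c\<in>E. g (br (D b) c) (br (d b) (d c)))"
  proof -
    \<comment> \<open>Two uses of \<open>dual_swap\<close>, in the index \<open>c\<close> and then
      in \<open>b\<close>, move the dual vectors into the second bracket.\<close>
    have "(\<Sum>b\<in>E. \<Sum>c\<in>E. g (br (D (d b)) (d c)) (br b c))
        = (\<Sum>b\<in>E. \<Sum>c\<in>E. g (br (D (d b)) c) (br b (d c)))"
      by (intro sum.cong refl dual_swap[of "\<lambda>x w. g (br (D (d _)) x) (br _ w)"])
        (auto simp: bilinear_def form_simps intro!: linearI)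
    also have "\<dots> = (\<Sum>c\<in>E. \<Sum>b\<in>E. g (br (D (d b)) c) (br b (d c)))"
      by (rule sum.swap)
    also have "\<dots> = (\<Sum>c\<in>E. \<Sum>b\<in>E. g (br (D b) c) (br (d b) (d c)))"
      by (intro sum.cong refl dual_swap[of "\<lambda>x w. g (br (D x) _) (br w (d _))"])
        (auto simp: bilinear_def form_simps linear_add[OF linD] linear_scale[OF linD] intro!: linearI)
    also have "\<dots> = (\<Sum>b\<in>E. \<Sum>c\<in>E. g (br (D b) c) (br (d b) (d c)))"
      by (rule sum.swap)
    finally show ?thesis .
  qed
  finally show ?thesis
    by (simp add: ricci_eq sum_subtractf flip: sum_divide_distrib)
qed

lemma einstein_trace_derivation:
  assumes "\<And>x. ricci_operator br g x = c *\<^sub>R x" and D: "derivation D"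
  shows "c * linear_trace D = 0"
proof -
  have "ricci_tensor br g x y = c * g x y" for x y
    using ricci_operator_iff[OF real_lie_algebra_axioms finite_E span_E, of x "c *\<^sub>R x"] assms(1)
    by (simp add: g_scale_left)
  then have "(\<Sum>j\<in>E. c * g (D j) (d j)) = 0"
    using ricci_derivation[OF D] by simp
  then show ?thesis
    using D by (simp add: trace_eq derivation_def sum_distrib_left)
qed

end

lemma einstein_derivation_traceless:
  fixes br :: "'a::real_vector \<Rightarrow> 'a \<Rightarrow> 'a"
  assumes br: "real_lie_algebra br" and g: "metric_form g" and nil: "nilpotent_bracket br"
    and S: "finite S" "span S = (UNIV :: 'a set)"
    and ric: "\<And>x. ricci_operator br g x = c *\<^sub>R x"
    and D: "real_lie_algebra.derivation br D" and "linear_trace D \<noteq> 0"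
  shows "c = 0"
proof -
  interpret real_lie_algebra br by fact
  interpret metric_form g by fact
  obtain E :: "'a set" where E: "independent E" "span E = UNIV" "finite E"
    using basis_exists_finite[OF S] .
  \<comment> \<open>The dual vector of a basis element represents its coordinate functional, through
    \<open>riesz_ex1\<close>.\<close>
  have "linear (\<lambda>x. representation E x c)" for c
    by (rule linearI)
      (simp_all add: E real_vector.representation_add real_vector.representation_scale)
  then have "\<forall>c. \<exists>r. \<forall>y. g r y = representation E y c"
    using riesz_ex1[OF S] by blast
  then obtain d where d: "g (d c) y = representation E y c" for c y
    by metis
  interpret nilpotent_metric_lie_algebra br g E d
    by unfold_locales
      (use E nil in \<open>auto simp: sym_g[of _ "d _"] d real_vector.representation_basis\<close>)
  show ?thesis
    using einstein_trace_derivation[OF ric D] assms(8) by simp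
qed

section \<open>Weighted bases and maximal abelian ideals\<close>

context real_lie_algebra
begin

definition traced_derivation :: bool where
  "traced_derivation \<longleftrightarrow> (\<exists>D. derivation D \<and> linear_trace D \<noteq> 0)"

text \<open>The derivation scales each basis vector by its weight. By antisymmetry the pairs with
  \<open>i \<le> j\<close> suffice. The trace is the sum of the weights, which is positive because
  they are natural numbers and one of them is nonzero.\<close>

lemma traced_derivation_weighted_basis:
  fixes P :: "('a \<times> nat) set"
  assumes fin: "finite P" and inj: "inj_on fst P"
    and ind: "independent (fst ` P)" and span: "span (fst ` P) = UNIV"
    and br: "\<And>a i b j. (a, i) \<in> P \<Longrightarrow> (b, j) \<in> P \<Longrightarrow> i \<le> j \<Longrightarrow>
      br a b \<in> span {c. (c, i + j) \<in> P}"
    and pos: "p \<in> P" "snd p > 0"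
  shows traced_derivation
proof -
  define w where "w a = real (snd (inv_into P fst a))" for a
  have w: "w a = real i" if "(a, i) \<in> P" for a i
    using inv_into_f_f[OF inj that] by (simp add: w_def)
  obtain D :: "'a \<Rightarrow> 'a" where D: "linear D" "\<And>a. a \<in> fst ` P \<Longrightarrow> D a = w a *\<^sub>R a"
    using linear_independent_extend[OF ind, of "\<lambda>a. w a *\<^sub>R a"] by blast
  have eigen: "D v = real k *\<^sub>R v" if "v \<in> span {c. (c, k) \<in> P}" for v k
    using that
  proof (induction rule: span_induct)
    case base
    show ?case
      using D(1) by (auto simp: subspace_def linear_0 linear_add linear_scale algebra_simps)
  next
    case (step x)
    then show ?case
      using D(2)[of x] w by force
  qed
  have le: "D (br a b) = br (D a) b + br a (D b)"
    if "(a, i) \<in> P" "(b, j) \<in> P" "i \<le> j" for a i b j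
  proof -
    have "D a = real i *\<^sub>R a" "D b = real j *\<^sub>R b"
      using that D(2) w by force+
    then show ?thesis
      using eigen[OF br[OF that]] by (simp add: br_simps scaleR_left_distrib)
  qed
  have basis: "D (br a b) = br (D a) b + br a (D b)" if ab: "a \<in> fst ` P" "b \<in> fst ` P" for a b
  proof -
    obtain i j where ij: "(a, i) \<in> P" "(b, j) \<in> P"
      using ab by auto
    show ?thesis
    proof (cases "i \<le> j")
      case False
      then have "D (br b a) = br (D b) a + br b (D a)"
        using le[OF ij(2,1)] by simp
      then show ?thesis
        using br_anti[of a b] br_anti[of "D a" b] br_anti[of a "D b"] linear_neg[OF D(1)] by simp
    qed (use le[OF ij] in simp)
  qed
  have lin: "linear (\<lambda>x. D (br x y))" "linear (\<lambda>x. br (D x) y + br x (D y))"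
    "linear (\<lambda>x. D (br y x))" "linear (\<lambda>x. br (D y) x + br y (D x))" for y
    using D(1) by (auto intro!: linearI simp: br_simps linear_add linear_scale algebra_simps)
  \<comment> \<open>Both sides are linear in each argument, so agreement on the basis extends one
    argument at a time.\<close>
  have "D (br a y) = br (D a) y + br a (D y)" if "a \<in> fst ` P" for a y
    using linear_eq_on_span[OF lin(3,4), of "fst ` P" a a y] basis[OF that] span by simp
  then have "D (br x y) = br (D x) y + br x (D y)" for x y
    using linear_eq_on_span[OF lin(1,2), of "fst ` P" y y x] span by simp
  then have "derivation D"
    using D(1) by (simp add: derivation_def)
  moreover have "linear_trace D \<noteq> 0"
  proof -
    have "linear_trace D = (\<Sum>a\<in>fst ` P. representation (fst ` P) (D a) a)"
      using linear_trace_eq[OF D(1) ind span] fin by simp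
    also have "\<dots> = (\<Sum>a\<in>fst ` P. w a)"
      by (intro sum.cong refl)
        (simp add: D(2) real_vector.representation_scale real_vector.representation_basis ind span)
    also have "\<dots> = (\<Sum>p\<in>P. real (snd p))"
      by (subst sum.reindex[OF inj]) (auto intro!: sum.cong simp: w)
    also have "\<dots> > 0"
      using fin pos by (intro sum_pos2[of P p]) auto
    finally show ?thesis
      by simp
  qed
  ultimately show ?thesis
    unfolding traced_derivation_def by blast
qed

section \<open>Ideals in a nilpotent Lie algebra\<close>

definition ideal :: "'a set \<Rightarrow> bool" where
  "ideal I \<longleftrightarrow> subspace I \<and> (\<forall>x. \<forall>y\<in>I. br x y \<in> I)"

lemma ideal_span_insert:
  assumes "ideal (span S)" and "\<And>x. br x b \<in> span S"
  shows "ideal (span (insert b S))"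
  unfolding ideal_def
proof (intro conjI allI ballI)
  fix x y
  assume "y \<in> span (insert b S)"
  then obtain k where "y - k *\<^sub>R b \<in> span S"
    by (auto simp: span_breakdown_eq)
  then have "br x (y - k *\<^sub>R b) + k *\<^sub>R br x b \<in> span S"
    using assms unfolding ideal_def by (blast intro: span_add span_scale)
  then show "br x y \<in> span (insert b S)"
    using span_mono[of S "insert b S"] by (auto simp: br_simps)
qed simp

lemma br_in_span_insert:
  assumes "z \<in> span (insert b S)" "br x b \<in> I" "\<And>s. s \<in> span S \<Longrightarrow> br x s \<in> I" "subspace I"
  shows "br x z \<in> I"
proof -
  obtain k where k: "z - k *\<^sub>R b \<in> span S"
    using assms(1) by (auto simp: span_breakdown_eq)
  have "br x (z - k *\<^sub>R b) + k *\<^sub>R br x b \<in> I"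
    using assms(2-4) k by (intro subspace_add subspace_scale) auto
  then show ?thesis
    by (simp add: br_simps)
qed

end

text \<open>The dimension bound is phrased through independent sets so that it includes
  finite-dimensionality.\<close>

locale nilpotent_lie_algebra_dim_6 = real_lie_algebra br
  for br :: "'a::real_vector \<Rightarrow> 'a \<Rightarrow> 'a" +
  assumes nilpotent: "nilpotent_bracket br"
    and independent_bound: "independent (A :: 'a set) \<Longrightarrow> finite A \<and> card A \<le> 6"
begin

text \<open>In the last term of the lower central series that meets \<open>J\<close> outside
  \<open>I\<close>, an element of \<open>J\<close> is central modulo \<open>I\<close>: bracketing
  moves it into the next term, whose intersection with \<open>J\<close> lies in
  \<open>I\<close>.\<close>

lemma ideal_step:
  assumes I: "ideal I" and J: "ideal J" and "I \<subset> J"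
  obtains b where "b \<in> J" "b \<notin> I" "\<And>x. br x b \<in> I"
proof -
  obtain n where "lcs n = {0}"
    using nilpotent by (auto simp: nilpotent_bracket_def)
  then have "J \<inter> lcs n \<subseteq> I"
    using I subspace_0 by (auto simp: ideal_def)
  moreover have "\<not> J \<inter> lcs 0 \<subseteq> I"
    using assms(3) by auto
  ultimately obtain k where k: "\<not> J \<inter> lcs k \<subseteq> I" "J \<inter> lcs (Suc k) \<subseteq> I"
    using dec_induct[of 0 n "\<lambda>k. \<not> J \<inter> lcs k \<subseteq> I"] by auto
  then obtain b where "b \<in> J" "b \<in> lcs k" "b \<notin> I"
    by blast
  then show ?thesis
    using that[of b] k(2) J br_in_lcs_Suc[of b k] unfolding ideal_def by blast
qed

lemma ideal_UNIV: "ideal UNIV"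
  by (simp add: ideal_def)

text \<open>Take \<open>\<beta>\<close> of maximal cardinality. The centralizer \<open>C\<close> is
  an ideal, and if it were larger than \<open>span \<beta>\<close>, adjoining an element of
  \<open>C\<close> that is central modulo \<open>span \<beta>\<close> would give a larger abelian
  ideal.\<close>

lemma maximal_abelian_ideal:
  obtains \<beta> where "independent \<beta>" "ideal (span \<beta>)"
    "\<And>x y. x \<in> span \<beta> \<Longrightarrow> y \<in> span \<beta> \<Longrightarrow> br x y = 0"
    "\<And>z. (\<And>y. y \<in> span \<beta> \<Longrightarrow> br z y = 0) \<Longrightarrow> z \<in> span \<beta>"
proof -
  define P where "P \<beta> \<longleftrightarrow> independent \<beta> \<and> ideal (span \<beta>) \<and>
    (\<forall>x\<in>span \<beta>. \<forall>y\<in>span \<beta>. br x y = 0)" for \<beta>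
  have P0: "P {}"
    by (simp add: P_def ideal_def br_simps real_vector.independent_empty)
  have "\<forall>\<beta>. P \<beta> \<longrightarrow> card \<beta> < 7"
    using independent_bound unfolding P_def by fastforce
  from ex_has_greatest_nat[where P = P, OF P0 this] obtain \<beta> where \<beta>: "P \<beta>" and max: "\<And>\<gamma>. P \<gamma> \<Longrightarrow> card \<gamma> \<le> card \<beta>"
    by blast
  have ind: "independent \<beta>" and id: "ideal (span \<beta>)"
    and ab: "\<And>x y. x \<in> span \<beta> \<Longrightarrow> y \<in> span \<beta> \<Longrightarrow> br x y = 0"
    using \<beta> by (auto simp: P_def)
  define C where "C = {z. \<forall>y\<in>span \<beta>. br z y = 0}"
  have "ideal C"
    using id unfolding ideal_def C_def by (auto simp: subspace_def br_simps br_br)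
  have "C = span \<beta>"
  proof (rule ccontr)
    assume "C \<noteq> span \<beta>"
    then have "span \<beta> \<subset> C"
      using ab by (auto simp: C_def)
    then obtain b where b: "b \<in> C" "b \<notin> span \<beta>" "\<And>x. br x b \<in> span \<beta>"
      using ideal_step[OF id \<open>ideal C\<close>] by blast
    have "br x y = 0" if x: "x \<in> span (insert b \<beta>)" and y: "y \<in> span (insert b \<beta>)" for x y
    proof -
      obtain k l where "x - k *\<^sub>R b \<in> span \<beta>" "y - l *\<^sub>R b \<in> span \<beta>"
        using x y by (auto simp: span_breakdown_eq)
      then have "br (x - k *\<^sub>R b) (y - l *\<^sub>R b) = 0" "br b (x - k *\<^sub>R b) = 0" "br b (y - l *\<^sub>R b) = 0"
        using ab b(1) by (auto simp: C_def)
      then show ?thesis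
        using br_anti[of x b] by (simp add: br_simps br_self)
    qed
    then have "P (insert b \<beta>)"
      using real_vector.independent_insertI[OF b(2) ind] ideal_span_insert[OF id b(3)]
      by (auto simp: P_def)
    moreover have "card (insert b \<beta>) = Suc (card \<beta>)"
      using b(2) independent_bound[OF ind] span_base by (intro card_insert_disjoint) auto
    ultimately show False
      using max by fastforce
  qed
  then show ?thesis
    using that[OF ind id ab] by (auto simp: C_def)
qed


lemma codim_1_traced_derivation:
  assumes "independent \<beta>" "finite \<beta>" "x \<notin> span \<beta>" "span (insert x \<beta>) = UNIV" "ideal (span \<beta>)"
    and "\<And>x y. x \<in> span \<beta> \<Longrightarrow> y \<in> span \<beta> \<Longrightarrow> br x y = 0" and "b \<in> \<beta>"
  shows traced_derivation
proof (rule traced_derivation_weighted_basis)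
  \<comment> \<open>Weight zero on \<open>x\<close> fits because \<open>br x\<close> maps the ideal,
    all of weight one, to itself.\<close>
  let ?P = "insert (x, 0) (\<beta> \<times> {1::nat})"
  have P: "fst ` ?P = insert x \<beta>"
    by force
  show "finite ?P" "span (fst ` ?P) = UNIV" "independent (fst ` ?P)" "(b, 1) \<in> ?P" "0 < snd (b, 1::nat)"
    using assms real_vector.independent_insertI[OF assms(3,1)] unfolding P by auto
  show "inj_on fst ?P"
    using assms(3) span_base by (force simp: inj_on_def)
  show "br a b \<in> span {c. (c, i + j) \<in> ?P}" if "(a, i) \<in> ?P" "(b, j) \<in> ?P" "i \<le> j" for a i b j
    using that assms(5,6) by (auto simp: br_self span_zero span_base ideal_def)
qed

lemma abelian_traced_derivation:
  fixes \<beta> :: "'a set"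
  assumes "independent \<beta>" "finite \<beta>" "span \<beta> = UNIV"
    and "\<And>x y. br x y = 0" and "b \<in> \<beta>"
  shows traced_derivation
proof (rule traced_derivation_weighted_basis)
  let ?P = "\<beta> \<times> {1::nat}"
  have P: "fst ` ?P = \<beta>"
    by force
  show "finite ?P" "span (fst ` ?P) = UNIV" "independent (fst ` ?P)" "(b, 1) \<in> ?P" "0 < snd (b, 1::nat)"
    using assms unfolding P by auto
  show "inj_on fst ?P"
    by (force simp: inj_on_def)
  show "br a b \<in> span {c. (c, i + j) \<in> ?P}" for a i b j
    using assms(4) by (simp add: span_zero)
qed

text \<open>Iterated on an abelian ideal, viewed as a module over the quotient, this gives the
  radical filtration.\<close>

definition comm :: "'a set \<Rightarrow> 'a set" where
  "comm U = span {br z v | z v. v \<in> U}"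

lemma br_in_comm: "v \<in> U \<Longrightarrow> br z v \<in> comm U"
  unfolding comm_def by (auto intro!: span_base)

lemma comm_subset: "(\<And>z v. v \<in> U \<Longrightarrow> br z v \<in> W) \<Longrightarrow> subspace W \<Longrightarrow> comm U \<subseteq> W"
  unfolding comm_def by (intro span_minimal) auto

lemma comm_le: "ideal U \<Longrightarrow> comm U \<subseteq> U"
  by (rule comm_subset) (auto simp: ideal_def)

lemma subspace_comm: "subspace (comm U)"
  by (simp add: comm_def)

lemma ideal_comm: "ideal U \<Longrightarrow> ideal (comm U)"
  using comm_le br_in_comm subspace_comm unfolding ideal_def by blast

text \<open>A Nakayama argument: if \<open>comm U = U\<close>, then \<open>U\<close> lies in every
  term of the lower central series.\<close>

lemma comm_psubset:
  assumes U: "ideal U" and "U \<noteq> {0}"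
  shows "comm U \<subset> U"
proof (rule ccontr)
  assume "\<not> ?thesis"
  then have eq: "comm U = U"
    using comm_le[OF U] by blast
  have "U \<subseteq> lcs k" for k
  proof (induction k)
    case (Suc k)
    then have "comm U \<subseteq> lcs (Suc k)"
      by (intro comm_subset subspace_lcs br_in_lcs_Suc) auto
    then show ?case
      using eq by simp
  qed simp
  moreover obtain n where "lcs n = {0}"
    using nilpotent by (auto simp: nilpotent_bracket_def)
  ultimately have "U \<subseteq> {0}"
    by metis
  moreover have "0 \<in> U"
    using U subspace_0 by (auto simp: ideal_def)
  ultimately show False
    using assms(2) by auto
qed

end

section \<open>Abelian ideals of codimension two\<close>

lemma span_insert_mono: "span S \<subseteq> span T \<Longrightarrow> span (insert a S) \<subseteq> span (insert a T)"
  for a :: "'a::real_vector"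
  by (auto simp: span_insert)

lemma independent_4:
  fixes a1 a2 a3 a4 :: "'a::real_vector"
  assumes "a1 \<noteq> 0" "a2 \<notin> span {a1}" "a3 \<notin> span {a2, a1}" "a4 \<notin> span {a3, a2, a1}"
  shows "independent {a4, a3, a2, a1}" "card {a4, a3, a2, a1} = 4" "distinct [a4, a3, a2, a1]"
proof -
  show "independent {a4, a3, a2, a1}"
    using assms by (simp add: real_vector.independent_insertI real_vector.independent_empty)
  have "a2 \<noteq> a1" "a3 \<noteq> a2" "a3 \<noteq> a1" "a4 \<noteq> a3" "a4 \<noteq> a2" "a4 \<noteq> a1"
    using assms span_base[of a2 "{a1}"] span_base[of a3 "{a2, a1}"] span_base[of a4 "{a3, a2, a1}"]
    by auto
  then show "card {a4, a3, a2, a1} = 4" "distinct [a4, a3, a2, a1]"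
    by auto
qed

text \<open>\<open>br_xy\<close> makes the quotient by \<open>span \<beta>\<close> abelian, so
  \<open>x\<close> and \<open>y\<close> act on the ideal by commuting nilpotent maps; the dimension
  bound leaves at most four dimensions for the ideal.\<close>

locale codim_2_abelian_ideal = nilpotent_lie_algebra_dim_6 br
  for br :: "'a::real_vector \<Rightarrow> 'a \<Rightarrow> 'a" +
  fixes \<beta> :: "'a set" and x y :: 'a
  assumes ind_xy: "independent (insert x (insert y \<beta>))"
    and notin_xy: "x \<notin> insert y \<beta>" "y \<notin> \<beta>"
    and span_xy: "span (insert x (insert y \<beta>)) = UNIV"
    and ideal_\<beta>: "ideal (span \<beta>)"
    and abelian: "u \<in> span \<beta> \<Longrightarrow> v \<in> span \<beta> \<Longrightarrow> br u v = 0"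
    and br_xy: "br x y \<in> span \<beta>"
begin

definition gen :: "'a \<Rightarrow> 'a \<Rightarrow> bool" where
  "gen u v \<longleftrightarrow> span (insert u (insert v \<beta>)) = UNIV"

abbreviation B :: "'a set" where "B \<equiv> span \<beta>"

lemma finite_\<beta>: "finite \<beta>" and card_\<beta>: "card \<beta> \<le> 4" and ind_\<beta>: "independent \<beta>"
  using independent_bound[OF ind_xy] notin_xy
    real_vector.independent_mono[OF ind_xy] by auto

lemma card_le_B: "independent A \<Longrightarrow> A \<subseteq> B \<Longrightarrow> finite A \<and> card A \<le> card \<beta>"
  using real_vector.independent_span_bound[OF finite_\<beta>] by blast

lemma gen_xy: "gen x y" "gen y x"
  using span_xy by (simp_all add: gen_def insert_commute)

lemma gen_change:
  assumes "gen u v" "u \<in> span (insert u' (insert v' \<beta>))" "v \<in> span (insert u' (insert v' \<beta>))"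
  shows "gen u' v'"
proof -
  have "insert u (insert v \<beta>) \<subseteq> span (insert u' (insert v' \<beta>))"
    using assms by (auto intro: span_base)
  then show ?thesis
    using assms(1) span_minimal[OF _ subspace_span] unfolding gen_def by blast
qed

lemma gen_shear:
  assumes "gen u v"
  shows "gen u (v - k *\<^sub>R u)" "gen (u + k *\<^sub>R v) v"
proof -
  have "(v - k *\<^sub>R u) + k *\<^sub>R u \<in> span (insert u (insert (v - k *\<^sub>R u) \<beta>))"
    by (intro span_add span_scale span_base) auto
  then show "gen u (v - k *\<^sub>R u)"
    by (intro gen_change[OF assms]) (auto intro: span_base)
  have "(u + k *\<^sub>R v) - k *\<^sub>R v \<in> span (insert (u + k *\<^sub>R v) (insert v \<beta>))"
    by (intro span_diff span_scale span_base) auto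
  then show "gen (u + k *\<^sub>R v) v"
    by (intro gen_change[OF assms]) (auto intro: span_base)
qed

lemma gen_decompose:
  assumes "gen u v"
  obtains p q b where "z = p *\<^sub>R u + q *\<^sub>R v + b" "b \<in> B"
proof -
  have "z \<in> span (insert u (insert v \<beta>))"
    using assms by (simp add: gen_def)
  then obtain p q where "z - p *\<^sub>R u - q *\<^sub>R v \<in> B"
    by (auto simp: span_breakdown_eq)
  then show ?thesis
    using that[of p q "z - p *\<^sub>R u - q *\<^sub>R v"] by simp
qed

text \<open>A spanning set with no more elements than the dimension has no redundant member;
  \<open>big\<close> is the lower bound on the size of spanning sets.\<close>

lemma gen_basis:
  assumes g: "gen u v" and C: "independent C" "span C = B"
  shows "independent (insert u (insert v C))" "span (insert u (insert v C)) = UNIV"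
    "v \<notin> B" "u \<notin> span (insert v C)" "u \<noteq> v"
proof -
  have fC: "finite C" "card C \<le> card \<beta>"
    using card_le_B[OF C(1)] C(2) span_superset[of C] by auto
  have span: "span (insert w C) = span (insert w \<beta>)" for w
    using C(2) by (simp add: span_insert)
  then show s: "span (insert u (insert v C)) = UNIV"
    using g C(2) unfolding gen_def by (simp add: span_insert[of u])
  have c: "card (insert x (insert y \<beta>)) = Suc (Suc (card \<beta>))"
    using notin_xy finite_\<beta> by simp
  have big: "Suc (Suc (card \<beta>)) \<le> card A" if "span A = UNIV" "finite A" for A :: "'a set"
    using real_vector.independent_span_bound[OF that(2) ind_xy] that c by auto
  show "v \<notin> B"
  proof
    assume "v \<in> B"
    then have "span (insert v C) = span C"
      using C(2) by (simp add: real_vector.span_redundant)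
    then have "span (insert u C) = UNIV"
      using s by (simp add: span_insert[of u])
    from big[OF this] show False
      using fC card_insert_le_m1[of "Suc (card C)" C u] by (simp add: card_insert_if split: if_splits)
  qed
  show u: "u \<notin> span (insert v C)"
  proof
    assume "u \<in> span (insert v C)"
    then have "span (insert v C) = UNIV"
      using s real_vector.span_redundant by metis
    from big[OF this] show False
      using fC by (simp add: card_insert_if split: if_splits)
  qed
  then show "u \<noteq> v"
    by (auto intro: span_base)
  show "independent (insert u (insert v C))"
    using u \<open>v \<notin> B\<close> C by (intro real_vector.independent_insertI) auto
qed

lemma br_UNIV_in_B: "br u v \<in> B"
proof -
  obtain p q b where u: "u = p *\<^sub>R x + q *\<^sub>R y + b" "b \<in> B"
    using gen_decompose[OF gen_xy(1)] .
  obtain p' q' b' where v: "v = p' *\<^sub>R x + q' *\<^sub>R y + b'" "b' \<in> B"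
    using gen_decompose[OF gen_xy(1)] .
  have "br x b' \<in> B" "br y b' \<in> B" "br x b \<in> B" "br y b \<in> B" "br b b' = 0"
    "br y x \<in> B" "br b x \<in> B" "br b y \<in> B"
    using ideal_\<beta> u v abelian br_xy br_anti[of b x] br_anti[of b y] br_anti[of y x]
    by (auto simp: ideal_def span_neg)
  then show ?thesis
    using br_xy unfolding u v
    by (auto simp: br_simps br_self intro!: span_add span_scale span_neg)
qed

text \<open>\<open>br z w\<close> lies in the abelian ideal and so acts on it as zero.\<close>

lemma br_commute: "v \<in> B \<Longrightarrow> br z (br w v) = br w (br z v)"
  using br_br[of z w v] abelian[OF br_UNIV_in_B[of z w]] by simp

text \<open>The ideal acts trivially on itself, so only combinations of \<open>u\<close> and
  \<open>v\<close> matter.\<close>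

lemma comm_subset_gen:
  assumes g: "gen u v" and U: "U \<subseteq> B" and W: "subspace W"
    and br: "\<And>b. b \<in> U \<Longrightarrow> br u b \<in> W" "\<And>b. b \<in> U \<Longrightarrow> br v b \<in> W"
  shows "comm U \<subseteq> W"
proof (rule comm_subset[OF _ W])
  fix z b assume b: "b \<in> U"
  obtain p q c where z: "z = p *\<^sub>R u + q *\<^sub>R v + c" "c \<in> B"
    using gen_decompose[OF g] .
  have "br z b = p *\<^sub>R br u b + q *\<^sub>R br v b"
    using abelian[of c b] z b U by (auto simp: br_simps)
  then show "br z b \<in> W"
    using br b W by (auto intro: subspace_add subspace_scale)
qed

lemma comm_B_eq:
  assumes "gen u v" and "n \<in> comm B"
  obtains p q where "p \<in> B" "q \<in> B" "n = br u p + br v q"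
proof -
  let ?W = "{br u p + br v q | p q. p \<in> B \<and> q \<in> B}"
  have "subspace ?W"
    unfolding subspace_def
  proof (intro conjI ballI allI)
    show "0 \<in> ?W"
      by (rule CollectI, rule exI[of _ 0], rule exI[of _ 0]) (simp add: br_simps span_zero)
    fix s t :: 'a and c :: real
    assume "s \<in> ?W"
    then obtain p q where s: "s = br u p + br v q" "p \<in> B" "q \<in> B"
      by blast
    have "c *\<^sub>R s = br u (c *\<^sub>R p) + br v (c *\<^sub>R q)"
      by (simp add: s br_simps algebra_simps)
    then show "c *\<^sub>R s \<in> ?W"
      using s span_scale by blast
    assume "t \<in> ?W"
    then obtain p' q' where t: "t = br u p' + br v q'" "p' \<in> B" "q' \<in> B"
      by blast
    have "s + t = br u (p + p') + br v (q + q')"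
      by (simp add: s t br_simps algebra_simps)
    then show "s + t \<in> ?W"
      using s t span_add by blast
  qed
  moreover have "br u b \<in> ?W" if "b \<in> B" for b
    by (rule CollectI, rule exI[of _ b], rule exI[of _ 0]) (simp add: br_simps span_zero that)
  moreover have "br v b \<in> ?W" if "b \<in> B" for b
    by (rule CollectI, rule exI[of _ 0], rule exI[of _ b]) (simp add: br_simps span_zero that)
  ultimately have "comm B \<subseteq> ?W"
    by (intro comm_subset_gen[OF assms(1)]) auto
  then show ?thesis
    using that assms(2) by blast
qed

text \<open>Changing \<open>u\<close> and \<open>v\<close> by elements of \<open>B\<close> does not affect their action on \<open>B\<close>, but changes
  \<open>br u v\<close> by an arbitrary element of \<open>comm B\<close>.\<close>
lemma traced_derivation_weighted_module:
  fixes Q :: "('a \<times> nat) set"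
  assumes g: "gen u v" and inj: "inj_on fst Q"
    and ind: "independent (fst ` Q)" and span: "span (fst ` Q) = B"
    and ij: "0 < i" "i \<le> j" "\<And>c k. (c, k) \<in> Q \<Longrightarrow> j \<le> k"
    and cover: "\<And>b. b \<in> B \<Longrightarrow> \<exists>n\<in>comm B. b - n \<in> span {c. (c, i + j) \<in> Q}"
    and br: "\<And>c k. (c, k) \<in> Q \<Longrightarrow> br u c \<in> span {b. (b, i + k) \<in> Q}"
      "\<And>c k. (c, k) \<in> Q \<Longrightarrow> br v c \<in> span {b. (b, j + k) \<in> Q}"
  shows traced_derivation
proof -
  obtain n where n: "n \<in> comm B" "br u v - n \<in> span {c. (c, i + j) \<in> Q}"
    using cover br_UNIV_in_B by blast
  obtain p q where pq: "p \<in> B" "q \<in> B" "n = br u p + br v q"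
    using comm_B_eq[OF g n(1)] .
  \<comment> \<open>The signs make the two shifts together subtract \<open>br u p + br v q\<close>,
    which is \<open>n\<close>; what is left of \<open>br u v\<close> has weight
    \<open>i + j\<close>.\<close>
  define u' v' where "u' = u + q" and "v' = v - p"
  have br_u'v': "br u' v' = br u v - n"
    using abelian[OF pq(2,1)] br_anti[of q v] by (simp add: u'_def v'_def br_simps pq(3))
  have u': "br u' c = br u c" and v': "br v' c = br v c" if "c \<in> B" for c
    using abelian[OF pq(1) that] abelian[OF pq(2) that] by (auto simp: u'_def v'_def br_simps)
  have "gen u' v'"
  proof (rule gen_change[OF g])
    show "u \<in> span (insert u' (insert v' \<beta>))" "v \<in> span (insert u' (insert v' \<beta>))"
      using span_diff[OF span_base[of u' "insert u' (insert v' \<beta>)"], of q]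
        span_add[OF span_base[of v' "insert u' (insert v' \<beta>)"], of p]
        pq(1,2) span_mono[of \<beta> "insert u' (insert v' \<beta>)"]
      by (auto simp: u'_def v'_def)
  qed
  note gb = gen_basis[OF this ind span]
  have QB: "c \<in> B" if "(c, k) \<in> Q" for c k
    using that span span_base[of c "fst ` Q"] by force
  let ?P = "insert (u', i) (insert (v', j) Q)"
  have mono: "span {c. (c, k) \<in> Q} \<subseteq> span {c. (c, k) \<in> ?P}" for k
    by (intro span_mono) auto
  have uv: "br u' v' \<in> span {c. (c, i + j) \<in> ?P}"
    using subsetD[OF mono n(2)] br_u'v' by (simp only:)
  have uQ: "br u' c \<in> span {b. (b, i + k) \<in> ?P}" if "(c, k) \<in> Q" for c k
    using subsetD[OF mono br(1)[OF that]] u'[OF QB[OF that]] by (simp only:)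
  have vQ: "br v' c \<in> span {b. (b, j + k) \<in> ?P}" if "(c, k) \<in> Q" for c k
    using subsetD[OF mono br(2)[OF that]] v'[OF QB[OF that]] by (simp only:)
  show ?thesis
  proof (rule traced_derivation_weighted_basis)
    have fP: "fst ` ?P = insert u' (insert v' (fst ` Q))"
      by simp
    show "independent (fst ` ?P)" "span (fst ` ?P) = UNIV"
      unfolding fP using gb by auto
    then have "finite (fst ` ?P)"
      using independent_bound by blast
    have "v' \<notin> fst ` Q" "u' \<notin> insert v' (fst ` Q)"
      using gb(3,4) span_base[of _ "fst ` Q"] span_base[of _ "insert v' (fst ` Q)"] span by blast+
    then show injP: "inj_on fst ?P"
      using inj by (force simp: inj_on_def)
    show "finite ?P"
      by (rule finite_imageD[OF \<open>finite (fst ` ?P)\<close> injP])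
    show "(u', i) \<in> ?P" "0 < snd (u', i)"
      using ij by auto
    show "br a b \<in> span {c. (c, k + l) \<in> ?P}"
      if ab: "(a, k) \<in> ?P" "(b, l) \<in> ?P" for a k b l
    proof -
      consider "a = b" | "a = u'" "k = i" "b = v'" "l = j" | "a = v'" "k = j" "b = u'" "l = i"
        | "a = u'" "k = i" "(b, l) \<in> Q" | "a = v'" "k = j" "(b, l) \<in> Q"
        | "(a, k) \<in> Q" "b = u'" "l = i" | "(a, k) \<in> Q" "b = v'" "l = j" | "(a, k) \<in> Q" "(b, l) \<in> Q"
        using ab by blast
      then show ?thesis
      proof cases
        case 1
        then show ?thesis
          by (simp add: br_self span_zero)
      next
        case 2
        show ?thesis
          unfolding 2 by (rule uv)
      next
        case 3
        show ?thesis
          unfolding 3 br_anti[of v'] add.commute[of j] by (rule span_neg[OF uv])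
      next
        case 4
        show ?thesis
          unfolding 4 by (rule uQ) fact
      next
        case 5
        show ?thesis
          unfolding 5 by (rule vQ) fact
      next
        case 6
        show ?thesis
          unfolding 6 br_anti[of a] add.commute[of k] by (rule span_neg, rule uQ) fact
      next
        case 7
        show ?thesis
          unfolding 7 br_anti[of a] add.commute[of k] by (rule span_neg, rule vQ) fact
      next
        case 8
        then show ?thesis
          using abelian[of a b] QB by (simp add: span_zero)
      qed
    qed
  qed
qed

section \<open>Cases by the radical filtration of the ideal\<close>

abbreviation "N \<equiv> comm B"
abbreviation "N2 \<equiv> comm N"
abbreviation "N3 \<equiv> comm N2"
abbreviation "N4 \<equiv> comm N3"

lemma ideal_N: "ideal N" "ideal N2" "ideal N3" "ideal N4"
  using ideal_\<beta> ideal_comm by auto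

lemma N_le: "N \<subseteq> B" "N2 \<subseteq> N" "N3 \<subseteq> N2" "N4 \<subseteq> N3" "N2 \<subseteq> B" "N3 \<subseteq> B" "N4 \<subseteq> B"
  using comm_le ideal_\<beta> ideal_N by blast+

lemma span_N: "span N = N" "span N2 = N2" "span N3 = N3" "span N4 = N4"
  by (simp_all add: comm_def)

lemma not_independent_5:
  assumes "a1 \<noteq> 0" "a2 \<notin> span {a1}" "a3 \<notin> span {a2, a1}" "a4 \<notin> span {a3, a2, a1}"
    and "a5 \<notin> span {a4, a3, a2, a1}"
  shows "\<not> {a5, a4, a3, a2, a1} \<subseteq> B"
proof
  assume "{a5, a4, a3, a2, a1} \<subseteq> B"
  moreover have "independent (insert a5 {a4, a3, a2, a1})"
    by (rule real_vector.independent_insertI[OF assms(5) independent_4(1)[OF assms(1-4)]])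
  moreover have "card (insert a5 {a4, a3, a2, a1}) = 5"
    using assms(5) independent_4(2)[OF assms(1-4)] span_base[of a5 "{a4, a3, a2, a1}"]
    by (subst card_insert_disjoint) auto
  ultimately show False
    using card_le_B[of "{a5, a4, a3, a2, a1}"] card_\<beta> by auto
qed

text \<open>\<open>x\<close> and \<open>y\<close> get weight 1, \<open>N\<close> gets weight 3 and a
  complement of \<open>N\<close> in \<open>B\<close> gets weight 2, the weight of
  \<open>br x y\<close> after correction by \<open>N\<close>.\<close>

lemma N2_zero_traced_derivation:
  assumes "N2 = {0}"
  shows traced_derivation
proof -
  obtain \<nu> where \<nu>: "\<nu> \<subseteq> N" "independent \<nu>" "N \<subseteq> span \<nu>"
    using real_vector.maximal_independent_subset[of N] by blast
  have "\<nu> \<subseteq> B"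
    using \<nu>(1) N_le by blast
  then obtain C where C: "\<nu> \<subseteq> C" "C \<subseteq> B" "independent C" "B \<subseteq> span C"
    using real_vector.maximal_independent_subset_extend[of \<nu> B] \<nu>(2) by blast
  let ?Q = "(C - \<nu>) \<times> {2::nat} \<union> \<nu> \<times> {3::nat}"
  have fQ: "fst ` ?Q = C"
    using C(1) by (auto simp: image_Un)
  have Q: "{c. (c, 1 + 1) \<in> ?Q} = C - \<nu>" "{c. (c, 1 + 2) \<in> ?Q} = \<nu>"
    by auto
  show ?thesis
  proof (rule traced_derivation_weighted_module[OF gen_xy(1), where Q = ?Q and i = 1 and j = 1])
    show "inj_on fst ?Q"
      by (auto simp: inj_on_def)
    show "independent (fst ` ?Q)" "span (fst ` ?Q) = B"
      unfolding fQ using C span_minimal[OF C(2)] by auto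
    show "\<exists>n\<in>N. b - n \<in> span {c. (c, 1 + 1) \<in> ?Q}" if "b \<in> B" for b
    proof -
      have "b \<in> span ((C - \<nu>) \<union> \<nu>)"
        using that C(1,4) by (metis Diff_partition Un_commute subsetD)
      then obtain s n where "b = s + n" "s \<in> span (C - \<nu>)" "n \<in> span \<nu>"
        unfolding real_vector.span_Un by blast
      then show ?thesis
        unfolding Q using span_minimal[OF \<nu>(1)] span_N(1) subspace_comm
        by (intro bexI[of _ n]) auto
    qed
    have "br z c \<in> span {b. (b, 1 + k) \<in> ?Q}" if ck: "(c, k) \<in> ?Q" for z c k
    proof (cases "k = 2")
      case True
      then have "br z c \<in> N"
        using ck C(2) by (intro br_in_comm) auto
      then show ?thesis
        using True \<nu>(3) unfolding True Q by blast
    next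
      case False
      then have "br z c \<in> N2"
        using ck \<nu>(1) by (intro br_in_comm) auto
      then show ?thesis
        using assms by (simp add: span_zero)
    qed
    then show "(c, k) \<in> ?Q \<Longrightarrow> br x c \<in> span {b. (b, 1 + k) \<in> ?Q}"
      "(c, k) \<in> ?Q \<Longrightarrow> br y c \<in> span {b. (b, 1 + k) \<in> ?Q}" for c k
      by blast+
  qed auto
qed

text \<open>By \<open>wide\<close>, \<open>N\<close> modulo \<open>N2\<close> has dimension at least
  two. As \<open>B\<close> has dimension at most four, the quotients of the filtration have
  dimensions 1, 2, 1. So one vector \<open>t\<close> generates the module, and \<open>br x t\<close>
  and \<open>br y t\<close> together with a vector of \<open>N2\<close> form a basis of
  \<open>N\<close>.\<close>

lemma wide_traced_derivation:
  assumes N2: "N2 \<noteq> {0}" and wide: "\<And>c. \<not> N \<subseteq> span (insert c N2)"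
  shows traced_derivation
proof -
  have "0 \<in> N2" "0 \<in> N" "0 \<in> B"
    using subspace_0 subspace_comm span_zero by auto
  then obtain d where d: "d \<in> N2" "d \<noteq> 0"
    using N2 by blast
  obtain c1 where c1: "c1 \<in> N" "c1 \<notin> N2"
    using wide[of 0] span_superset[of N2] span_N by (auto simp: span_insert_0)
  obtain c2 where c2: "c2 \<in> N" "c2 \<notin> span (insert c1 N2)"
    using wide[of c1] by blast
  have "N \<noteq> {0}"
    using N2 N_le \<open>0 \<in> N2\<close> by auto
  then have "B \<noteq> {0}"
    using N_le \<open>0 \<in> N\<close> by auto
  then obtain t where t: "t \<in> B" "t \<notin> N"
    using comm_psubset[OF ideal_\<beta>] by blast
  have in_B: "d \<in> B" "c1 \<in> B" "c2 \<in> B"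
    using d c1 c2 N_le by auto
  have sub: "span {d} \<subseteq> N2" "span {c1, d} \<subseteq> span (insert c1 N2)" "span {c2, c1, d} \<subseteq> N"
    using d c1 c2 N_le by (auto intro!: span_mono span_minimal subspace_comm del: subsetI)
  have ind: "c1 \<notin> span {d}" "c2 \<notin> span {c1, d}" "t \<notin> span {c2, c1, d}"
    using sub c1 c2 t by auto
  \<comment> \<open>A second independent vector of \<open>N2\<close> would give five independent
    vectors in \<open>B\<close>.\<close>
  have N2_eq: "N2 \<subseteq> span {d}"
  proof (rule ccontr)
    assume "\<not> ?thesis"
    then obtain d' where d': "d' \<in> N2" "d' \<notin> span {d}"
      by blast
    have "span {d', d} \<subseteq> N2" "span {c1, d', d} \<subseteq> span (insert c1 N2)" "span {c2, c1, d', d} \<subseteq> N"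
      using d d' c1 c2 N_le by (auto intro!: span_mono span_minimal subspace_comm del: subsetI)
    then have "\<not> {t, c2, c1, d', d} \<subseteq> B"
      using d d' c1 c2 t by (intro not_independent_5) auto
    then show False
      using in_B t d' N_le by auto
  qed
  have B_eq: "B \<subseteq> span {t, c2, c1, d}"
    using not_independent_5[OF d(2) ind] in_B t by blast
  have B_t: "B \<subseteq> span (insert t N)"
    using B_eq span_insert_mono[of "{c2, c1, d}" N t] sub(3) span_N by blast
  \<comment> \<open>\<open>c1\<close> and \<open>c2\<close> serve for counting only; the weighted
    basis uses these images of \<open>t\<close> instead.\<close>
  let ?c1 = "br x t" and ?c2 = "br y t"
  have in_N2: "br z s \<in> span {?c1, ?c2, d}" if "s \<in> N" for z s
    using br_in_comm[OF that] N2_eq span_mono[of "{d}" "{?c1, ?c2, d}"] by blast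
  have "N \<subseteq> span {?c1, ?c2, d}"
  proof (rule comm_subset_gen[OF gen_xy(1)])
    fix b assume "b \<in> B"
    then have b: "b \<in> span (insert t N)"
      using B_t by blast
    show "br x b \<in> span {?c1, ?c2, d}"
      by (rule br_in_span_insert[OF b _ in_N2]) (auto simp: span_N span_base)
    show "br y b \<in> span {?c1, ?c2, d}"
      by (rule br_in_span_insert[OF b _ in_N2]) (auto simp: span_N span_base)
  qed auto
  moreover have "{?c1, ?c2, d} \<subseteq> N"
    using d N_le br_in_comm[OF t(1)] by auto
  ultimately have spanN: "span {?c1, ?c2, d} = N"
    using span_minimal[OF _ subspace_comm] by blast
  obtain C where C: "C \<subseteq> {?c1, ?c2, d}" "independent C" "{?c1, ?c2, d} \<subseteq> span C"
    using real_vector.maximal_independent_subset[of "{?c1, ?c2, d}"] by blast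
  then have "finite C"
    by (simp add: finite_subset)
  have "independent {c2, c1, d}" "card {c2, c1, d} = 3"
    using independent_4[OF d(2) ind] real_vector.independent_mono[of "{t, c2, c1, d}" "{c2, c1, d}"]
    by auto
  moreover have "{c2, c1, d} \<subseteq> span C"
    using c1 c2 d N_le spanN C(3) span_minimal[OF C(3) subspace_span] by blast
  ultimately have "3 \<le> card C"
    using real_vector.independent_span_bound[OF \<open>finite C\<close>] by metis
  moreover have "card {?c1, ?c2, d} \<le> 3"
    by (simp add: card_insert_if)
  ultimately have Ceq: "C = {?c1, ?c2, d}" and card: "card {?c1, ?c2, d} = 3"
    using card_seteq[OF _ C(1)] card_mono[OF _ C(1)] by auto
  have dist: "?c1 \<noteq> ?c2" "?c1 \<noteq> d" "?c2 \<noteq> d"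
    using card by (auto simp: card_insert_if split: if_splits)
  \<comment> \<open>\<open>N2\<close> is a line, and \<open>N3\<close> is strictly smaller.\<close>
  have N3: "N3 = {0}"
  proof (rule ccontr)
    assume "N3 \<noteq> {0}"
    then obtain e where e: "e \<in> N3" "e \<noteq> 0"
      using subspace_0[OF subspace_comm, of N2] by blast
    then obtain k where k: "e = k *\<^sub>R d"
      using N_le N2_eq by (auto simp: span_singleton)
    then have "(1 / k) *\<^sub>R e = d"
      using e by simp
    then have "d \<in> N3"
      using e subspace_scale[OF subspace_comm] by metis
    then have "N2 \<subseteq> N3"
      using N2_eq span_minimal[of "{d}" N3] subspace_comm by blast
    then show False
      using comm_psubset[OF ideal_N(2) N2] by blast
  qed
  let ?Q = "{(t, 2), (?c1, 3), (?c2, 3), (d, 4::nat)}"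
  have tN: "t \<notin> {?c1, ?c2, d}"
    using t(2) spanN span_base[of t "{?c1, ?c2, d}"] by auto
  show ?thesis
  proof (rule traced_derivation_weighted_module[OF gen_xy(1), where Q = ?Q and i = 1 and j = 1])
    show "inj_on fst ?Q"
      using tN dist by (auto simp: inj_on_def)
    have fQ: "fst ` ?Q = insert t {?c1, ?c2, d}"
      by auto
    have "span (insert t {?c1, ?c2, d}) \<subseteq> B"
      using t in_B br_UNIV_in_B by (intro span_minimal) auto
    moreover have "B \<subseteq> span (insert t {?c1, ?c2, d})"
      using B_t span_insert_mono[of N "{?c1, ?c2, d}" t] spanN span_N by blast
    ultimately show "independent (fst ` ?Q)" "span (fst ` ?Q) = B"
      unfolding fQ using real_vector.independent_insertI[of t C] C(2) t(2) spanN Ceq by auto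
    show "\<exists>n\<in>N. b - n \<in> span {c. (c, 1 + 1) \<in> ?Q}" if b: "b \<in> B" for b
    proof -
      obtain k where "b - k *\<^sub>R t \<in> N"
        using subsetD[OF B_t b] by (auto simp: span_breakdown_eq[of _ t] span_N)
      then show ?thesis
        by (intro bexI[of _ "b - k *\<^sub>R t"]) (auto intro: span_scale span_base)
    qed
    have "br z s \<in> span {d}" if "s \<in> N" for z s
      using br_in_comm[OF that] N2_eq by blast
    moreover have "br z d = 0" for z
      using br_in_comm[OF d(1)] N3 by auto
    ultimately show "(c, k) \<in> ?Q \<Longrightarrow> br x c \<in> span {b. (b, 1 + k) \<in> ?Q}"
      "(c, k) \<in> ?Q \<Longrightarrow> br y c \<in> span {b. (b, 1 + k) \<in> ?Q}" for c k
      using br_in_comm[OF t(1)] by (auto simp: span_zero intro: span_base)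
  qed auto
qed

end

text \<open>The remaining case: \<open>N2\<close> is nonzero and \<open>N\<close> modulo
  \<open>N2\<close> is a line, spanned by the class of \<open>br u t\<close>. The generator
  \<open>v\<close> has been sheared along \<open>u\<close> so as to send \<open>t\<close> into
  \<open>N2\<close>.\<close>

locale codim_2_chain = codim_2_abelian_ideal br \<beta> x y
  for br :: "'a::real_vector \<Rightarrow> 'a \<Rightarrow> 'a" and \<beta> x y +
  fixes u v t c0 :: 'a
  assumes N2_nonzero: "N2 \<noteq> {0}" and narrow: "N \<subseteq> span (insert c0 N2)"
    and gen_uv: "gen u v" and t_in: "t \<in> B"
    and br_u_t: "br u t \<notin> N2" and br_v_t: "br v t \<in> N2"
begin

abbreviation c :: 'a where "c \<equiv> br u t"
abbreviation d :: 'a where "d \<equiv> br u c"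
abbreviation e :: 'a where "e \<equiv> br u d"

lemma chain_in: "c \<in> N" "d \<in> N2" "e \<in> N3" "br u e \<in> N4"
  "c \<in> B" "d \<in> B" "e \<in> B" "d \<in> N" "e \<in> N2" "e \<in> N"
proof -
  show in_N: "c \<in> N" "d \<in> N2" "e \<in> N3" "br u e \<in> N4"
    using t_in br_in_comm by auto
  show "d \<in> N" "e \<in> N2" "e \<in> N" "c \<in> B" "d \<in> B" "e \<in> B"
    using in_N N_le by blast+
qed

lemma N_c: "N \<subseteq> span (insert c N2)"
proof -
  have "c \<in> span (insert c0 N2)"
    using chain_in narrow by blast
  then have "c0 \<in> span (insert c N2)"
    using br_u_t by (rule real_vector.in_span_insert[where S = N2, unfolded span_N])
  then have "span (insert c0 N2) \<subseteq> span (insert c N2)"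
    by (intro span_minimal) (auto intro: span_base)
  then show ?thesis
    using narrow by blast
qed

lemma br_v_c: "br v c = br u (br v t)"
  by (rule br_commute[OF t_in])

lemma br_v_c_in: "br v c \<in> N3"
  unfolding br_v_c using br_v_t by (rule br_in_comm)

text \<open>\<open>N\<close> is spanned by \<open>c\<close> modulo \<open>N2\<close>, and
  \<open>br v c = br u (br v t)\<close> lies in \<open>N3\<close> because \<open>br v t\<close> lies
  in \<open>N2\<close>.\<close>

lemma br_v_N: "br v n \<in> N3" if "n \<in> N"
proof (rule br_in_span_insert[where b = c and S = N2])
  show "n \<in> span (insert c N2)"
    using that N_c by blast
qed (auto simp: br_v_c_in br_in_comm subspace_comm span_N)

lemma N2_d: "N2 \<subseteq> span (insert d N3)"
proof (rule comm_subset_gen[OF gen_uv N_le(1)])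
  fix n assume n: "n \<in> N"
  show "br u n \<in> span (insert d N3)"
    by (rule br_in_span_insert[OF subsetD[OF N_c n]]) (auto simp: span_N intro!: span_base br_in_comm)
  show "br v n \<in> span (insert d N3)"
    using br_v_N[OF n] by (auto intro: span_base)
qed auto

lemma d_notin: "d \<notin> N3"
proof
  assume "d \<in> N3"
  then have "N2 \<subseteq> N3"
    using N2_d by (simp add: insert_absorb span_N)
  then show False
    using comm_psubset[OF ideal_N(2) N2_nonzero] by blast
qed

text \<open>If \<open>br v s\<close> is \<open>k\<close> times \<open>c\<close> modulo
  \<open>N2\<close>, applying \<open>u\<close> gives \<open>k\<close> times \<open>d\<close> modulo
  \<open>N3\<close>. But \<open>u\<close> and \<open>v\<close> commute on \<open>B\<close> and
  \<open>v\<close> maps \<open>N\<close> into \<open>N3\<close>, so \<open>k = 0\<close>. This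
  matters when \<open>B\<close> needs generators besides \<open>t\<close>.\<close>

lemma br_v_B: "br v s \<in> N2" if s: "s \<in> B"
proof -
  have "br v s \<in> span (insert c N2)"
    using N_c br_in_comm[OF s] by blast
  then obtain k where k: "br v s - k *\<^sub>R c \<in> N2"
    by (auto simp: span_breakdown_eq span_N)
  have "br u (br v s) \<in> N3"
    using br_v_N[OF br_in_comm[OF s]] br_commute[OF s, of u v] by simp
  moreover have "br u (br v s - k *\<^sub>R c) \<in> N3"
    using k by (rule br_in_comm)
  ultimately have "br u (br v s) - br u (br v s - k *\<^sub>R c) \<in> N3"
    using subspace_comm subspace_diff by blast
  then have kd: "k *\<^sub>R d \<in> N3"
    by (simp add: br_simps)
  have "k = 0"
  proof (rule ccontr)
    assume "k \<noteq> 0"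
    then have "d = (1 / k) *\<^sub>R (k *\<^sub>R d)"
      by simp
    then show False
      using d_notin subspace_scale[OF subspace_comm kd] by metis
  qed
  then show ?thesis
    using k by simp
qed

lemma t_notin: "t \<notin> N"
  using br_u_t br_in_comm by blast

text \<open>Here \<open>d\<close> spans \<open>N2\<close>, and \<open>c\<close> and \<open>d\<close>
  span \<open>N\<close>. Weight 2 on \<open>v\<close> fits because \<open>v\<close> maps
  \<open>B\<close> into \<open>span {d}\<close>; the basis is chosen so that \<open>u\<close> maps
  its other vectors to multiples of \<open>c\<close>.\<close>

lemma short_chain_traced_derivation:
  assumes N3: "N3 = {0}"
  shows traced_derivation
proof -
  have N2_eq: "N2 \<subseteq> span {d}"
    using N2_d by (simp add: N3 insert_commute[of d 0] span_insert_0)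
  have N_eq: "N \<subseteq> span {c, d}"
    using N_c span_insert_mono[of N2 "{d}" c] N2_eq span_N by blast
  have d0: "d \<noteq> 0" and "c \<notin> span {d}" 
    using d_notin N3 br_u_t chain_in span_minimal[OF _ subspace_comm, of "{d}" N] by auto
  then have ind: "independent {c, d}" "c \<noteq> d"
    using span_base[of c "{d}"] real_vector.independent_insertI[of c "{d}"]
      real_vector.independent_insertI[of d "{}"] real_vector.independent_empty by auto
  \<comment> \<open>Every vector of \<open>B\<close> lies in \<open>K\<close> up to a multiple of
    \<open>c\<close>, since \<open>br u c = d\<close> can cancel the \<open>d\<close>-component of
    its image under \<open>u\<close>.\<close>
  define K where "K = {s \<in> B. br u s \<in> span {c}}"
  have "{c, d} \<subseteq> {c, d} \<union> K"
    by simp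
  then obtain C where C: "{c, d} \<subseteq> C" "C \<subseteq> {c, d} \<union> K" "independent C" "{c, d} \<union> K \<subseteq> span C"
    using real_vector.maximal_independent_subset_extend[OF _ ind(1)] by metis
  have CB: "C \<subseteq> B"
    using C(2) chain_in by (auto simp: K_def)
  have "B \<subseteq> span C"
  proof
    fix s assume s: "s \<in> B"
    have "br u s \<in> span (insert d {c})"
      using N_eq br_in_comm[OF s] by (auto simp: insert_commute)
    then obtain k where k: "br u s - k *\<^sub>R d \<in> span {c}"
      by (auto simp: span_breakdown_eq[of _ d])
    then have "s - k *\<^sub>R c \<in> K"
      using s chain_in by (auto simp: K_def br_simps intro!: span_diff span_scale)
    then have "s - k *\<^sub>R c + k *\<^sub>R c \<in> span C"
      using C by (intro span_add span_scale) (auto intro: span_base)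
    then show "s \<in> span C"
      by simp
  qed
  then have span_C: "span C = B"
    using span_minimal[OF CB] by auto
  let ?T = "C - {c, d}"
  let ?Q = "?T \<times> {3} \<union> {(c, 4), (d, 5::nat)}"
  have Q: "{q. (q, 1 + 2) \<in> ?Q} = ?T" "{q. (q, 1 + 3) \<in> ?Q} = {c}" "{q. (q, 2 + 3) \<in> ?Q} = {d}"
    "{q. (q, 1 + 4) \<in> ?Q} = {d}"
    by auto
  show ?thesis
  proof (rule traced_derivation_weighted_module[OF gen_uv, where Q = ?Q and i = 1 and j = 2])
    show "inj_on fst ?Q"
      using ind(2) by (auto simp: inj_on_def)
    have "fst ` ?Q = C"
      using C(1) by (auto simp: image_Un)
    then show "independent (fst ` ?Q)" "span (fst ` ?Q) = B"
      using C(3) span_C by auto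
    show "\<exists>n\<in>N. b - n \<in> span {q. (q, 1 + 2) \<in> ?Q}" if "b \<in> B" for b
    proof -
      have "b \<in> span (?T \<union> {c, d})"
        using that C(1) span_C by (metis Diff_partition Un_commute)
      then obtain s n where "b = s + n" "s \<in> span ?T" "n \<in> span {c, d}"
        unfolding real_vector.span_Un by blast
      moreover have "span {c, d} \<subseteq> N"
        using chain_in N_le by (intro span_minimal subspace_comm) auto
      ultimately show ?thesis
        unfolding Q by (intro bexI[of _ n]) auto
    qed
    have d: "br z d = 0" for z
      using br_in_comm[OF chain_in(2)] N3 by auto
    have T: "s \<in> ?T \<Longrightarrow> br u s \<in> span {c}" "s \<in> ?T \<Longrightarrow> br v s \<in> span {d}" for s
      using C(2) br_v_B N2_eq by (auto simp: K_def)
    show "br u s \<in> span {b. (b, 1 + k) \<in> ?Q}" if sk: "(s, k) \<in> ?Q" for s k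
    proof -
      consider "s \<in> ?T" "k = 3" | "s = c" "k = 4" | "s = d"
        using sk by auto
      then show ?thesis
      proof cases
        case 1
        show ?thesis
          unfolding 1 Q by (rule T) fact
      next
        case 2
        show ?thesis
          unfolding 2 Q by (simp add: span_base)
      next
        case 3
        show ?thesis
          unfolding 3 d by (rule span_zero)
      qed
    qed
    show "br v s \<in> span {b. (b, 2 + k) \<in> ?Q}" if sk: "(s, k) \<in> ?Q" for s k
    proof -
      consider "s \<in> ?T" "k = 3" | "s = c" | "s = d"
        using sk by auto
      then show ?thesis
      proof cases
        case 1
        show ?thesis
          unfolding 1 Q by (rule T) fact
      next
        case 2
        show ?thesis
          unfolding 2 using br_v_c_in N3 by (simp add: span_zero)
      next
        case 3
        show ?thesis
          unfolding 3 d by (rule span_zero)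
      qed
    qed
  qed auto
qed

text \<open>\<open>br v d = br u (br v c)\<close> lies in \<open>N4\<close>, so modulo
  \<open>N4\<close> only \<open>br u d\<close> contributes.\<close>

lemma N3_e: "N3 \<subseteq> span (insert e N4)"
proof (rule comm_subset_gen[OF gen_uv N_le(5)])
  fix n assume n: "n \<in> N2"
  then have n': "n \<in> span (insert d N3)"
    using N2_d by blast
  have "br v d = br u (br v c)"
    using br_commute chain_in by blast
  then have "br v d \<in> N4"
    using br_in_comm[OF br_v_c_in] by simp
  then show "br v n \<in> span (insert e N4)"
    by (intro br_in_span_insert[OF n']) (auto simp: span_N intro!: span_base br_in_comm)
  show "br u n \<in> span (insert e N4)"
    by (rule br_in_span_insert[OF n']) (auto simp: span_N intro!: span_base br_in_comm)
qed auto

section \<open>Chains of length four under \<open>u\<close>\<close>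

context
  assumes N3_nonzero: "N3 \<noteq> {0}"
begin

lemma e_notin: "e \<notin> N4"
proof
  assume "e \<in> N4"
  then have "N3 \<subseteq> N4"
    using N3_e by (simp add: insert_absorb span_N)
  then show False
    using comm_psubset[OF ideal_N(3) N3_nonzero] by blast
qed

text \<open>A nonzero \<open>f\<close> in \<open>N4\<close> would extend \<open>t\<close>,
  \<open>c\<close>, \<open>d\<close>, \<open>e\<close> to five independent vectors in
  \<open>B\<close>.\<close>

lemma N4_zero: "N4 = {0}"
proof (rule ccontr)
  assume "N4 \<noteq> {0}"
  then obtain f where f: "f \<in> N4" "f \<noteq> 0"
    using subspace_0[OF subspace_comm, of N3] by blast
  then have "f \<in> N3" "f \<in> N2" "f \<in> N"
    using N_le by blast+
  then have "span {f} \<subseteq> N4" "span {e, f} \<subseteq> N3" "span {d, e, f} \<subseteq> N2" "span {c, d, e, f} \<subseteq> N"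
    using f chain_in N_le by (auto intro!: span_minimal subspace_comm del: subsetI)
  then have "\<not> {t, c, d, e, f} \<subseteq> B"
    using f e_notin d_notin br_u_t t_notin by (intro not_independent_5) auto
  then show False
    using f chain_in t_in N_le by auto
qed

lemma span_chain: "span {e} = N3" "span {d, e} = N2" "span {c, d, e} = N"
proof -
  have "span {e} \<subseteq> N3" "span {d, e} \<subseteq> N2" "span {c, d, e} \<subseteq> N"
    using chain_in N_le by (auto intro!: span_minimal subspace_comm del: subsetI)
  moreover have 1: "N3 \<subseteq> span {e}"
    using N3_e by (simp add: N4_zero insert_commute[of e 0] span_insert_0)
  moreover have 2: "N2 \<subseteq> span {d, e}"
    using N2_d span_insert_mono[of N3 "{e}" d] 1 span_N by blast
  moreover have "N \<subseteq> span {c, d, e}"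
    using N_c span_insert_mono[of N2 "{d, e}" c] 2 span_N by blast
  ultimately show "span {e} = N3" "span {d, e} = N2" "span {c, d, e} = N"
    by auto
qed

lemma chain_basis: "independent {t, c, d, e}" "distinct [t, c, d, e]" "span {t, c, d, e} = B"
proof -
  have ne: "e \<noteq> 0" "d \<notin> span {e}" "c \<notin> span {d, e}" "t \<notin> span {c, d, e}"
    using e_notin d_notin br_u_t t_notin N4_zero span_chain by auto
  show "independent {t, c, d, e}" "distinct [t, c, d, e]"
    using independent_4[OF ne] by auto
  have "{t, c, d, e} \<subseteq> B"
    using t_in chain_in by auto
  moreover have "B \<subseteq> span {t, c, d, e}"
    using not_independent_5[OF ne] calculation by blast
  ultimately show "span {t, c, d, e} = B"
    using span_minimal[OF _ subspace_span] by blast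
qed

lemma br_v_t_eq: obtains p q where "br v t = p *\<^sub>R d + q *\<^sub>R e"
proof -
  have "br v t \<in> span {d, e}"
    using br_v_t span_chain by simp
  then obtain p q where "br v t - p *\<^sub>R d - q *\<^sub>R e = 0"
    by (auto simp: span_breakdown_eq)
  then show ?thesis
    using that[of p q] by (simp add: algebra_simps)
qed

lemma br_chain: "br u e = 0" "br v d = 0" "br v e = 0"
  using chain_in br_in_comm[OF chain_in(3)] br_v_N[OF chain_in(1)] N4_zero br_in_comm[OF br_v_c_in]
    br_commute[OF chain_in(5), of v u] by auto

lemma chain_cover: "\<exists>n\<in>N. b - n \<in> span {t}" if b: "b \<in> B"
proof -
  have "b \<in> span (insert t {c, d, e})"
    using b chain_basis by simp
  then obtain k where "b - k *\<^sub>R t \<in> N"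
    by (auto simp: span_breakdown_eq[of _ t] span_chain)
  then show ?thesis
    by (intro bexI[of _ "b - k *\<^sub>R t"]) (auto intro: span_scale span_base)
qed

text \<open>On \<open>B\<close>, \<open>v\<close> acts as \<open>p\<close> times the square of
  \<open>u\<close>, hence weight 2. The weight of \<open>t\<close> is 1 + 2, that of
  \<open>br u v\<close> modulo \<open>N\<close>.\<close>

lemma chain_weights_1_2:
  assumes bvt: "br v t = p *\<^sub>R d"
  shows traced_derivation
proof -
  let ?Q = "{(t, 3), (c, 4), (d, 5), (e, 6::nat)}"
  have bvc: "br v c = p *\<^sub>R e"
    by (simp add: br_v_c bvt br_simps)
  show ?thesis
  proof (rule traced_derivation_weighted_module[OF gen_uv, where Q = ?Q and i = 1 and j = 2])
    show "inj_on fst ?Q"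
      using chain_basis(2) by (auto simp: inj_on_def)
    show "independent (fst ` ?Q)" "span (fst ` ?Q) = B"
      using chain_basis by auto
    show "\<exists>n\<in>N. b - n \<in> span {q. (q, 1 + 2) \<in> ?Q}" if "b \<in> B" for b
      using chain_cover[OF that] by simp
    show "(s, k) \<in> ?Q \<Longrightarrow> br u s \<in> span {b. (b, 1 + k) \<in> ?Q}"
      "(s, k) \<in> ?Q \<Longrightarrow> br v s \<in> span {b. (b, 2 + k) \<in> ?Q}" for s k
      by (auto simp: bvt bvc br_chain span_zero intro: span_base span_scale[OF span_base])
  qed auto
qed

text \<open>On \<open>B\<close>, \<open>v\<close> acts as \<open>q\<close> times the cube of
  \<open>u\<close>, hence weight 3.\<close>

lemma chain_weights_1_3:
  assumes bvt: "br v t = q *\<^sub>R e"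
  shows traced_derivation
proof -
  let ?Q = "{(t, 4), (c, 5), (d, 6), (e, 7::nat)}"
  have bvc: "br v c = 0"
    by (simp add: br_v_c bvt br_simps br_chain)
  show ?thesis
  proof (rule traced_derivation_weighted_module[OF gen_uv, where Q = ?Q and i = 1 and j = 3])
    show "inj_on fst ?Q"
      using chain_basis(2) by (auto simp: inj_on_def)
    show "independent (fst ` ?Q)" "span (fst ` ?Q) = B"
      using chain_basis by auto
    show "\<exists>n\<in>N. b - n \<in> span {q. (q, 1 + 3) \<in> ?Q}" if "b \<in> B" for b
      using chain_cover[OF that] by simp
    show "(s, k) \<in> ?Q \<Longrightarrow> br u s \<in> span {b. (b, 1 + k) \<in> ?Q}"
      "(s, k) \<in> ?Q \<Longrightarrow> br v s \<in> span {b. (b, 3 + k) \<in> ?Q}" for s k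
      by (auto simp: bvt bvc br_chain span_zero intro: span_base span_scale[OF span_base])
  qed auto
qed

text \<open>If \<open>br v t = p d + q e\<close> with \<open>p \<noteq> 0\<close>, then replacing \<open>u\<close> by \<open>u + k v\<close> turns
  \<open>d\<close> into \<open>d + 2 k p e\<close>, so that \<open>k = q / (2 p\<^sup>2)\<close> absorbs the term \<open>q e\<close>.\<close>
lemma long_chain_traced_derivation: traced_derivation
proof -
  obtain p q where pq: "br v t = p *\<^sub>R d + q *\<^sub>R e"
    using br_v_t_eq .
  show ?thesis
  proof (cases "p = 0")
    case True
    then show ?thesis
      using pq by (intro chain_weights_1_3[of q]) simp
  next
    case False
    define k where "k = q / (2 * p\<^sup>2)"
    define u' where "u' = u + k *\<^sub>R v"
    have bvc: "br v c = p *\<^sub>R e"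
      by (simp add: br_v_c pq br_simps br_chain)
    have c': "br u' t = c + k *\<^sub>R br v t"
      by (simp add: u'_def br_simps)
    have "br u' t \<notin> N2"
    proof
      assume "br u' t \<in> N2"
      then have "br u' t - k *\<^sub>R br v t \<in> N2"
        using br_v_t by (intro subspace_diff subspace_scale subspace_comm)
      then show False
        using br_u_t by (simp add: c')
    qed
    then interpret sheared: codim_2_chain br \<beta> x y u' v t c0
      using N2_nonzero narrow gen_shear(2)[OF gen_uv, of k] t_in br_v_t
      by unfold_locales (simp_all add: u'_def)
    \<comment> \<open>The cross terms \<open>br u (br v t)\<close> and \<open>br v (br u t)\<close>
      both equal \<open>p\<close> times \<open>e\<close>, and \<open>br v (br v t)\<close> is
      zero.\<close>
    have "sheared.d = d + (2 * k * p) *\<^sub>R e"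
      unfolding c' unfolding u'_def pq
      by (simp add: br_simps bvc br_chain pq algebra_simps flip: scaleR_left.add)
    then have "p *\<^sub>R sheared.d = p *\<^sub>R d + (2 * k * p\<^sup>2) *\<^sub>R e"
      by (simp add: algebra_simps power2_eq_square)
    also have "2 * k * p\<^sup>2 = q"
      using False by (simp add: k_def)
    finally show ?thesis
      using pq N3_nonzero by (intro sheared.chain_weights_1_2[of p]) simp_all
  qed
qed

end

lemma chain_traced_derivation: traced_derivation
  using short_chain_traced_derivation long_chain_traced_derivation by blast

end

context codim_2_abelian_ideal
begin

lemma codim_2_traced_derivation: traced_derivation
proof (cases "N2 = {0} \<or> (\<forall>c. \<not> N \<subseteq> span (insert c N2))")
  case True
  then show ?thesis
    using N2_zero_traced_derivation wide_traced_derivation by blast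
next
  case False
  then obtain c0 where N2: "N2 \<noteq> {0}" and c0: "N \<subseteq> span (insert c0 N2)"
    by blast
  have "N \<noteq> {0}"
    using N2 N_le(2) subspace_0[OF subspace_comm, of N] by auto
  then have "\<not> N \<subseteq> N2"
    using comm_psubset[OF ideal_N(1)] by blast
  \<comment> \<open>As \<open>N\<close> is not inside \<open>N2\<close>, one of the two generators
    moves some \<open>t\<close> out of \<open>N2\<close>; it becomes \<open>u\<close>.\<close>
  then obtain t where t: "t \<in> B" "br x t \<notin> N2 \<or> br y t \<notin> N2"
    using comm_subset_gen[OF gen_xy(1), of B N2] subspace_comm by blast
  then obtain u v0 where uv: "gen u v0" "br u t \<notin> N2"
    using gen_xy by blast
  have "br u t \<in> span (insert c0 N2)"
    using c0 br_in_comm[OF t(1)] by blast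
  then have "c0 \<in> span (insert (br u t) N2)"
    using uv(2) by (rule real_vector.in_span_insert[where S = N2, unfolded span_N])
  then have "span (insert c0 N2) \<subseteq> span (insert (br u t) N2)"
    by (intro span_minimal) (auto intro: span_base)
  then have "br v0 t \<in> span (insert (br u t) N2)"
    using c0 br_in_comm[OF t(1)] by blast
  \<comment> \<open>Subtracting this multiple of \<open>u\<close> from \<open>v0\<close> makes the
    second generator send \<open>t\<close> into \<open>N2\<close>.\<close>
  then obtain k where k: "br v0 t - k *\<^sub>R br u t \<in> N2"
    by (auto simp: span_breakdown_eq span_N)
  interpret codim_2_chain br \<beta> x y u "v0 - k *\<^sub>R u" t c0
    by unfold_locales (use N2 c0 gen_shear(1)[OF uv(1)] t uv(2) k in \<open>simp_all add: br_simps\<close>)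
  show ?thesis
    by (rule chain_traced_derivation)
qed

end

section \<open>Abelian ideals of codimension three\<close>

context nilpotent_lie_algebra_dim_6
begin

text \<open>A flag of ideals spanned by \<open>a3\<close>, then \<open>a2\<close>, then
  \<open>a1\<close> makes the algebra act on \<open>span \<beta>\<close> by strictly triangular
  matrices of size 3. By \<open>self\<close>, the classes of \<open>y1\<close>, \<open>y2\<close>,
  \<open>y3\<close> act independently and fill this three-dimensional space, a Heisenberg algebra.
  The Jacobi identity and shifts by the ideal then normalize the brackets.\<close>

lemma codim_3_traced_derivation:
  assumes ind: "independent \<beta>" and id: "ideal (span \<beta>)"
    and ab: "\<And>x y. x \<in> span \<beta> \<Longrightarrow> y \<in> span \<beta> \<Longrightarrow> br x y = 0"
    and self: "\<And>z. (\<And>y. y \<in> span \<beta> \<Longrightarrow> br z y = 0) \<Longrightarrow> z \<in> span \<beta>"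
    and y1: "y1 \<notin> span \<beta>" and y2: "y2 \<notin> span (insert y1 \<beta>)"
    and y3: "y3 \<notin> span (insert y2 (insert y1 \<beta>))"
  shows traced_derivation
proof -
  let ?B = "span \<beta>"
  have "independent (insert y3 (insert y2 (insert y1 \<beta>)))"
    using real_vector.independent_insertI[OF y3 real_vector.independent_insertI[OF y2
          real_vector.independent_insertI[OF y1 ind]]] .
  moreover have "y1 \<notin> \<beta>" "y2 \<notin> insert y1 \<beta>" "y3 \<notin> insert y2 (insert y1 \<beta>)"
    using y1 y2 y3 span_base[of y1 \<beta>] span_base[of y2 "insert y1 \<beta>"]
      span_base[of y3 "insert y2 (insert y1 \<beta>)"] by auto
  ultimately have fin: "finite \<beta>" and card: "card \<beta> \<le> 3"
    using independent_bound[of "insert y3 (insert y2 (insert y1 \<beta>))"] by auto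
  have lin: "p = 0 \<and> q = 0 \<and> r = 0" if v: "p *\<^sub>R y1 + q *\<^sub>R y2 + r *\<^sub>R y3 \<in> ?B" for p q r
  proof -
    have divide: "w \<in> span S" if "k *\<^sub>R w \<in> span S" "k \<noteq> 0" for k :: real and w :: 'a and S
      using span_scale[OF that(1), of "1 / k"] that(2) by simp
    let ?v = "p *\<^sub>R y1 + q *\<^sub>R y2 + r *\<^sub>R y3"
    have "?v - q *\<^sub>R y2 - p *\<^sub>R y1 \<in> span (insert y2 (insert y1 \<beta>))"
      using v span_mono[of \<beta> "insert y2 (insert y1 \<beta>)"]
      by (intro span_diff span_scale) (auto intro: span_base)
    then have r: "r = 0"
      using divide[of r y3] y3 by auto
    have "?v - p *\<^sub>R y1 \<in> span (insert y1 \<beta>)"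
      using v span_mono[of \<beta> "insert y1 \<beta>"]
      by (intro span_diff span_scale) (auto intro: span_base)
    then have q: "q = 0"
      using divide[of q y2] y2 r by auto
    then show ?thesis
      using divide[of p y1 \<beta>] y1 r v by auto
  qed
  have id0: "ideal {0}"
    by (simp add: ideal_def br_simps)
  \<comment> \<open>The ideal cannot have dimension 0, 1 or 2: some vector outside it would act on
    it as zero, against \<open>self\<close>.\<close>
  have "?B \<noteq> {0}"
  proof
    assume "?B = {0}"
    then have "y1 \<in> ?B"
      by (intro self) (simp add: br_simps)
    then show False
      using y1 by blast
  qed
  then have "{0} \<subset> ?B"
    using span_zero[of \<beta>] by auto
  then obtain a3 where a3: "a3 \<in> ?B" "a3 \<noteq> 0" and br_a3: "\<And>x. br x a3 = 0"
    using ideal_step[OF id0 id] by auto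
  have id3: "ideal (span {a3})"
    using ideal_span_insert[of "{}" a3] id0 br_a3 by simp
  have kill3: "br z b = 0" if "b \<in> span {a3}" for z b
    using that br_a3 by (auto simp: span_singleton br_simps)
  have sub3: "span {a3} \<subseteq> ?B"
    using a3 by (intro span_minimal) auto
  have "?B \<noteq> span {a3}"
  proof
    assume eq: "?B = span {a3}"
    have "y1 \<in> ?B"
      by (rule self) (simp add: eq kill3)
    then show False
      using y1 by blast
  qed
  then have "span {a3} \<subset> ?B"
    using sub3 by auto
  then obtain a2 where a2: "a2 \<in> ?B" "a2 \<notin> span {a3}" and "\<And>x. br x a2 \<in> span {a3}"
    using ideal_step[OF id3 id] by blast
  then have "\<forall>x. \<exists>k. br x a2 = k *\<^sub>R a3"
    by (auto simp: span_singleton)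
  then obtain \<omega> where br_a2: "\<And>x. br x a2 = \<omega> x *\<^sub>R a3"
    by metis
  have uniq: "p = 0 \<and> q = 0" if "p *\<^sub>R a2 + q *\<^sub>R a3 = 0" for p q
  proof -
    have "p = 0"
    proof (rule ccontr)
      assume "p \<noteq> 0"
      moreover have "p *\<^sub>R a2 = (- q) *\<^sub>R a3"
        using that by (simp add: add_eq_0_iff2)
      then have "(1 / p) *\<^sub>R (p *\<^sub>R a2) \<in> span {a3}"
        by (simp only:) (intro span_scale span_base, simp)
      ultimately show False
        using a2(2) by simp
    qed
    then show ?thesis
      using that a3 by simp
  qed
  have id2: "ideal (span {a2, a3})"
    by (rule ideal_span_insert[OF id3]) (simp add: br_a2 span_base span_scale)
  have kill2: "br z b = 0" if "b \<in> span {a2, a3}" "\<omega> z = 0" for z b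
  proof -
    have "br z b \<in> {0}"
      by (rule br_in_span_insert[OF that(1)]) (auto simp: br_a2 that kill3)
    then show ?thesis
      by simp
  qed
  have "?B \<noteq> span {a2, a3}"
  proof
    assume eq: "?B = span {a2, a3}"
    \<comment> \<open>Only \<open>\<omega>\<close> acts on a two-dimensional ideal, and this
      combination of \<open>y1\<close> and \<open>y2\<close> is in its kernel.\<close>
    have "\<omega> y2 *\<^sub>R y1 - \<omega> y1 *\<^sub>R y2 \<in> ?B"
    proof (rule self)
      fix b assume "b \<in> ?B"
      moreover have "\<omega> (\<omega> y2 *\<^sub>R y1 - \<omega> y1 *\<^sub>R y2) = 0"
        using br_a2[of "\<omega> y2 *\<^sub>R y1 - \<omega> y1 *\<^sub>R y2"] a3(2) by (simp add: br_simps br_a2[of y1] br_a2[of y2] mult.commute)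
      ultimately show "br (\<omega> y2 *\<^sub>R y1 - \<omega> y1 *\<^sub>R y2) b = 0"
        using kill2 eq by blast
    qed
    then have "\<omega> y1 = 0"
      using lin[of "\<omega> y2" "- \<omega> y1" 0] by simp
    then have "y1 \<in> ?B"
      by (intro self) (simp add: eq kill2)
    then show False
      using y1 by blast
  qed
  moreover have "span {a2, a3} \<subseteq> ?B"
    using a3 a2 by (intro span_minimal) auto
  ultimately have "span {a2, a3} \<subset> ?B"
    by auto
  then obtain a1 where a1: "a1 \<in> ?B" "a1 \<notin> span {a2, a3}" and "\<And>x. br x a1 \<in> span {a2, a3}"
    using ideal_step[OF id2 id] by blast
  then have "\<forall>x. \<exists>p q. br x a1 - p *\<^sub>R a2 - q *\<^sub>R a3 = 0"
    by (auto simp: span_breakdown_eq)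
  then obtain \<phi> \<psi> where "\<And>x. br x a1 - \<phi> x *\<^sub>R a2 - \<psi> x *\<^sub>R a3 = 0"
    by metis
  then have br_a1: "br x a1 = \<phi> x *\<^sub>R a2 + \<psi> x *\<^sub>R a3" for x
    by (metis add.commute diff_add_cancel add_0)
  have a123: "{a1, a2, a3} \<subseteq> ?B"
    using a1 a2 a3 by auto
  have B_le: "?B \<subseteq> span {a1, a2, a3}"
  proof
    fix a0 assume a0: "a0 \<in> ?B"
    show "a0 \<in> span {a1, a2, a3}"
    proof (rule ccontr)
      assume "a0 \<notin> span {a1, a2, a3}"
      note four = independent_4[OF a3(2) a2(2) a1(2) this]
      have "{a0, a1, a2, a3} \<subseteq> ?B"
        using a0 a123 by auto
      then show False
        using real_vector.independent_span_bound[OF fin four(1)] four(2) card by auto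
    qed
  qed
  then have B_eq: "span {a1, a2, a3} = ?B"
    using span_minimal[OF a123] by auto
  have kill1: "z \<in> ?B" if "br z a1 = 0" "br z a2 = 0" for z
  proof (rule self)
    fix b assume "b \<in> ?B"
    then have b: "b \<in> span {a1, a2, a3}"
      using B_le by blast
    have "br z b \<in> {0}"
      by (rule br_in_span_insert[OF b]) (use that kill2[of _ z] a3(2) br_a2[of z] in auto)
    then show "br z b = 0"
      by simp
  qed
  \<comment> \<open>The three entries of the strictly triangular matrix by which \<open>z\<close>
    acts.\<close>
  define \<Phi> where "\<Phi> z = (\<phi> z, \<psi> z, \<omega> z)" for z
  have \<omega>: "\<omega> (z + w) = \<omega> z + \<omega> w" "\<omega> (k *\<^sub>R z) = k * \<omega> z" for z w k
  proof -
    have "br (z + w) a2 = br z a2 + br w a2" "br (k *\<^sub>R z) a2 = k *\<^sub>R br z a2"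
      by (simp_all only: br_simps)
    then have "\<omega> (z + w) *\<^sub>R a3 = (\<omega> z + \<omega> w) *\<^sub>R a3" "\<omega> (k *\<^sub>R z) *\<^sub>R a3 = (k * \<omega> z) *\<^sub>R a3"
      unfolding br_a2 by (simp_all add: scaleR_left_distrib)
    then show "\<omega> (z + w) = \<omega> z + \<omega> w" "\<omega> (k *\<^sub>R z) = k * \<omega> z"
      using a3(2) by auto
  qed
  have \<phi>: "\<phi> (z + w) = \<phi> z + \<phi> w \<and> \<psi> (z + w) = \<psi> z + \<psi> w"
    "\<phi> (k *\<^sub>R z) = k * \<phi> z \<and> \<psi> (k *\<^sub>R z) = k * \<psi> z" for z w k
  proof -
    have "br (z + w) a1 - br z a1 - br w a1 = 0" "br (k *\<^sub>R z) a1 - k *\<^sub>R br z a1 = 0"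
      by (simp_all add: br_simps)
    then have "(\<phi> (z + w) - \<phi> z - \<phi> w) *\<^sub>R a2 + (\<psi> (z + w) - \<psi> z - \<psi> w) *\<^sub>R a3 = 0"
      "(\<phi> (k *\<^sub>R z) - k * \<phi> z) *\<^sub>R a2 + (\<psi> (k *\<^sub>R z) - k * \<psi> z) *\<^sub>R a3 = 0"
      unfolding br_a1 by (simp_all add: algebra_simps)
    from this[THEN uniq] show "\<phi> (z + w) = \<phi> z + \<phi> w \<and> \<psi> (z + w) = \<psi> z + \<psi> w"
      "\<phi> (k *\<^sub>R z) = k * \<phi> z \<and> \<psi> (k *\<^sub>R z) = k * \<psi> z"
      by auto
  qed
  have lin\<Phi>: "linear \<Phi>"
    by (rule linearI) (simp_all add: \<Phi>_def \<omega> \<phi>)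
  let ?Y = "{y1, y2, y3}"
  have ker: "v = 0" if v: "v \<in> span ?Y" "\<Phi> v = 0" for v
  proof -
    obtain p q r where "v - p *\<^sub>R y1 - q *\<^sub>R y2 - r *\<^sub>R y3 = 0"
      using v(1) by (auto simp: span_breakdown_eq)
    then have v_eq: "v = p *\<^sub>R y1 + q *\<^sub>R y2 + r *\<^sub>R y3"
      by (simp add: algebra_simps)
    have "v \<in> ?B"
      using v(2) by (intro kill1) (auto simp: \<Phi>_def br_a1 br_a2 zero_prod_def)
    then show ?thesis
      using lin[of p q r] v_eq by simp
  qed
  have inj: "inj_on \<Phi> (span ?Y)"
  proof (rule inj_onI)
    fix v w assume "v \<in> span ?Y" "w \<in> span ?Y" "\<Phi> v = \<Phi> w"
    then have "v - w = 0"
      by (intro ker span_diff) (simp_all add: linear_diff[OF lin\<Phi>])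
    then show "v = w"
      by simp
  qed
  have ne: "y1 \<noteq> y2" "y1 \<noteq> y3" "y2 \<noteq> y3"
    using lin[of 1 "-1" 0] lin[of 1 0 "-1"] lin[of 0 1 "-1"] span_zero[of \<beta>] by auto
  have "independent ?Y"
    using real_vector.independent_mono[OF \<open>independent (insert y3 (insert y2 (insert y1 \<beta>)))\<close>, of ?Y]
    by auto
  then have "independent (\<Phi> ` ?Y)"
    using linear_independent_injective_image[OF lin\<Phi>] inj by blast
  moreover have "card (\<Phi> ` ?Y) = 3"
    using card_image[OF inj_on_subset[OF inj span_superset]] ne by simp
  ultimately have "UNIV \<subseteq> span (\<Phi> ` ?Y)"
    by (intro card_ge_dim_independent) auto
  then have surj: "\<exists>v. \<Phi> v = w" for w
    unfolding linear_span_image[OF lin\<Phi>] by (metis UNIV_I imageE subsetD)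
  \<comment> \<open>Generators of the Heisenberg algebra; their bracket \<open>z\<close> supplies
    the third entry.\<close>
  obtain x y where "\<Phi> x = (1, 0, 0)" "\<Phi> y = (0, 0, 1)"
    using surj by metis
  then have x: "br x a1 = a2" "br x a2 = 0" and y: "br y a1 = 0" "br y a2 = a3"
    by (auto simp: \<Phi>_def br_a1 br_a2)
  define z where "z = br x y"
  have z: "br z a1 = - a3" "br z a2 = 0"
    by (simp_all add: z_def br_br x y br_a3 br_simps)
  have coords: "\<exists>p q r. w = p *\<^sub>R a1 + q *\<^sub>R a2 + r *\<^sub>R a3" if "w \<in> ?B" for w
  proof -
    have "w \<in> span {a1, a2, a3}"
      using that B_le by blast
    then obtain p q r where "w - p *\<^sub>R a1 - q *\<^sub>R a2 - r *\<^sub>R a3 = 0"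
      by (auto simp: span_breakdown_eq)
    then have "w = p *\<^sub>R a1 + q *\<^sub>R a2 + r *\<^sub>R a3"
      by (simp add: algebra_simps)
    then show ?thesis
      by blast
  qed
  have "br x z \<in> ?B" "br y z \<in> ?B"
    by (intro kill1; simp add: br_br x y z br_a3 br_simps)+
  then obtain v1 v2 v3 u1 u2 u3 where
    xz: "br x z = v1 *\<^sub>R a1 + v2 *\<^sub>R a2 + v3 *\<^sub>R a3" and
    yz: "br y z = u1 *\<^sub>R a1 + u2 *\<^sub>R a2 + u3 *\<^sub>R a3"
    using coords by meson
  \<comment> \<open>The Jacobi identity, with the third term \<open>br z z\<close> equal to
    zero.\<close>
  have "br x (br y z) - br y (br x z) = 0"
    using jacobi[of x y z] br_anti[of z x] br_self[of z] by (simp add: br_simps flip: z_def)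
  then have "u1 *\<^sub>R a2 + (- v2) *\<^sub>R a3 = 0"
    by (simp add: xz yz br_simps x y br_a3)
  then have v2: "v2 = 0" and u1: "u1 = 0"
    using uniq[of u1 "- v2"] by auto
  \<comment> \<open>The shift of \<open>x\<close> removes the \<open>a3\<close>-term of
    \<open>br x z\<close>. That of \<open>br y z\<close> is removed in two halves, through
    \<open>y'\<close> and through \<open>z'\<close>, so that \<open>br x' y' = z'\<close> still
    holds.\<close>
  define x' y' z' where "x' = x - v3 *\<^sub>R a1" and "y' = y - (u3 / 2) *\<^sub>R a1"
    and "z' = z - (u3 / 2) *\<^sub>R a2"
  have ab': "br a1 a2 = 0" "br a2 a1 = 0" "br a1 a3 = 0" "br a3 a1 = 0" "br a2 a3 = 0" "br a3 a2 = 0"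
    using ab a123 by auto
  have x': "br x' a1 = a2" "br x' a2 = 0" and y': "br y' a1 = 0" "br y' a2 = a3"
    and z': "br z' a1 = - a3" "br z' a2 = 0"
    by (simp_all add: x'_def y'_def z'_def br_simps x y z ab' br_self)
  have x'y': "br x' y' = z'"
    using br_anti[of a1 y] y
    by (simp add: x'_def y'_def z'_def br_simps x br_self flip: z_def)
  have x'z': "br x' z' = v1 *\<^sub>R a1"
    using br_anti[of a1 z] z by (simp add: x'_def z'_def br_simps x ab' xz v2)
  have y'z': "br y' z' = u2 *\<^sub>R a2"
    using br_anti[of a1 z] z
    by (simp add: y'_def z'_def br_simps y ab' yz u1 flip: scaleR_left.add scaleR_left.diff)
  have z'_notin: "z' \<notin> span {a1, a2, a3}"
    using ab[of z' a1] z' a3 a123 B_eq by auto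
  have y'_notin: "y' \<notin> span {z', a1, a2, a3}"
  proof
    assume "y' \<in> span {z', a1, a2, a3}"
    then obtain k where "y' - k *\<^sub>R z' \<in> ?B"
      by (auto simp: span_breakdown_eq[of _ z'] B_eq)
    then have "br (y' - k *\<^sub>R z') a2 = 0"
      using ab a2 by blast
    then show False
      using a3 by (simp add: br_simps y' z')
  qed
  have x'_notin: "x' \<notin> span {y', z', a1, a2, a3}"
  proof
    assume "x' \<in> span {y', z', a1, a2, a3}"
    then obtain k l where "x' - k *\<^sub>R y' - l *\<^sub>R z' \<in> ?B"
      by (auto simp: span_breakdown_eq[of _ z'] span_breakdown_eq[of _ y'] B_eq)
    then have "br (x' - k *\<^sub>R y' - l *\<^sub>R z') a1 = 0"
      using ab a1 by blast
    then have "1 *\<^sub>R a2 + l *\<^sub>R a3 = 0"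
      by (simp add: br_simps x' y' z')
    then show False
      using uniq[of 1 l] by simp
  qed
  note four = independent_4[OF a3(2) a2(2) a1(2) z'_notin]
  have ind6: "independent {x', y', z', a1, a2, a3}"
    using real_vector.independent_insertI[OF x'_notin
        real_vector.independent_insertI[OF y'_notin four(1)]] .
  have dist: "distinct [x', y', z', a1, a2, a3]"
    using four(3) span_base[of x' "{y', z', a1, a2, a3}"] span_base[of y' "{z', a1, a2, a3}"]
      x'_notin y'_notin by auto
  have span6: "span {x', y', z', a1, a2, a3} = UNIV"
  proof (rule ccontr)
    assume "\<not> ?thesis"
    then obtain w where w: "w \<notin> span {x', y', z', a1, a2, a3}"
      by blast
    have "card (insert w {x', y', z', a1, a2, a3}) = 7"
      using dist w span_base[of w "{x', y', z', a1, a2, a3}"] by (subst card_insert_disjoint) auto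
    then show False
      using independent_bound[OF real_vector.independent_insertI[OF w ind6]] by simp
  qed
  \<comment> \<open>\<open>a3\<close> has weight 7, reached from \<open>br y' a2\<close> as 2 + 5
    and from \<open>br z' a1\<close> as 3 + 4.\<close>
  let ?P = "{(x', 1), (y', 2), (z', 3), (a1, 4), (a2, 5), (a3, 7::nat)}"
  show ?thesis
  proof (rule traced_derivation_weighted_basis)
    show "inj_on fst ?P"
      using dist by (auto simp: inj_on_def)
    show "finite ?P" "independent (fst ` ?P)" "span (fst ` ?P) = UNIV" "(x', 1) \<in> ?P" "0 < snd (x', 1::nat)"
      using ind6 span6 by auto
    show "br a b \<in> span {c. (c, i + j) \<in> ?P}" if "(a, i) \<in> ?P" "(b, j) \<in> ?P" "i \<le> j" for a i b j
      using that
      by (auto simp: br_self span_zero x'y' x'z' y'z' x' y' z' br_a3 ab'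
          intro: span_base span_scale[OF span_base] span_neg[OF span_base])
  qed
qed

text \<open>The codimension of a self-centralizing abelian ideal decides which weighting applies. On
  the zero algebra every trace is zero, so it must be excluded.\<close>

lemma nonzero_traced_derivation:
  assumes "w \<noteq> (0 :: 'a)"
  shows traced_derivation
proof -
  obtain \<beta> where ind: "independent \<beta>" and id: "ideal (span \<beta>)"
    and ab: "\<And>x y. x \<in> span \<beta> \<Longrightarrow> y \<in> span \<beta> \<Longrightarrow> br x y = 0"
    and self: "\<And>z. (\<And>y. y \<in> span \<beta> \<Longrightarrow> br z y = 0) \<Longrightarrow> z \<in> span \<beta>"
    using maximal_abelian_ideal by blast
  have fin: "finite \<beta>"
    using independent_bound[OF ind] by simp
  have "\<beta> \<noteq> {}"
  proof
    assume "\<beta> = {}"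
    then have "w \<in> span \<beta>"
      by (intro self) (simp add: br_simps)
    then show False
      using \<open>\<beta> = {}\<close> assms by simp
  qed
  then obtain b where b: "b \<in> \<beta>"
    by blast
  show ?thesis
  proof (cases "span \<beta> = UNIV")
    case True
    then show ?thesis
      using ind fin ab b by (intro abelian_traced_derivation[of \<beta> b]) auto
  next
    case False
    then have psub: "span \<beta> \<subset> UNIV"
      by auto
    obtain y1 where y1: "y1 \<notin> span \<beta>" "\<And>x. br x y1 \<in> span \<beta>"
      by (rule ideal_step[OF id ideal_UNIV psub]) (rule that)
    have ind1: "independent (insert y1 \<beta>)"
      by (rule real_vector.independent_insertI[OF y1(1) ind])
    show ?thesis
    proof (cases "span (insert y1 \<beta>) = UNIV")
      case True
      then show ?thesis
        using codim_1_traced_derivation[OF ind fin y1(1) True id ab b] by blast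
    next
      case False
      then obtain y2 where y2: "y2 \<notin> span (insert y1 \<beta>)"
        by blast
      show ?thesis
      proof (cases "span (insert y2 (insert y1 \<beta>)) = UNIV")
        case True
        \<comment> \<open>\<open>y1\<close> is central modulo \<open>span \<beta>\<close>, which
          puts \<open>br y2 y1\<close> into the ideal.\<close>
        interpret codim_2_abelian_ideal br \<beta> y2 y1
        proof unfold_locales
          show "y1 \<notin> \<beta>" "y2 \<notin> insert y1 \<beta>"
            using y1 y2 span_base[of y1 \<beta>] span_base[of y2 "insert y1 \<beta>"] by auto
        qed (fact real_vector.independent_insertI[OF y2 ind1] True id ab y1(2))+
        show ?thesis
          by (rule codim_2_traced_derivation)
      next
        case False
        then obtain y3 where y3: "y3 \<notin> span (insert y2 (insert y1 \<beta>))"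
          by blast
        show ?thesis
          by (rule codim_3_traced_derivation[OF ind id ab self y1(1) y2 y3])
      qed
    qed
  qed
qed

end

theorem theorem4p3:
  fixes br :: "'a::real_vector \<Rightarrow> 'a \<Rightarrow> 'a"
    and g :: "'a \<Rightarrow> 'a \<Rightarrow> real"
  assumes "real_lie_algebra br"
    and "\<exists>S::'a set. finite S \<and> span S = UNIV"
    and "dim (UNIV :: 'a set) \<le> 6"
    and "nilpotent_bracket br"
    and "metric_form g"
    and "einstein_metric br g"
  shows "ricci_flat br g"
proof -
  obtain S :: "'a set" where S: "finite S" "span S = UNIV"
    using assms(2) by blast
  obtain c where c: "\<And>x. ricci_operator br g x = c *\<^sub>R x"
    using assms(6) unfolding einstein_metric_def by blast
  \<comment> \<open>The finite spanning set \<open>S\<close> makes every basis finite, so that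
    \<open>dim\<close> really bounds independent sets.\<close>
  have bound: "finite A \<and> card A \<le> 6" if A: "independent A" for A :: "'a set"
  proof -
    obtain C where C: "A \<subseteq> C" "independent C" "UNIV \<subseteq> span C"
      using real_vector.maximal_independent_subset_extend[OF subset_UNIV A] by metis
    have "finite C"
      by (rule finite_basis[OF S C(2)])
    moreover have "card C = dim (UNIV :: 'a set)"
      by (rule real_vector.basis_card_eq_dim[OF subset_UNIV C(3,2)])
    ultimately show ?thesis
      using C(1) assms(3) card_mono[of C A] finite_subset[of A C] by auto
  qed
  interpret real_lie_algebra br
    by fact
  interpret nilpotent_lie_algebra_dim_6 br
    by unfold_locales (fact assms(4), erule bound)
  \<comment> \<open>Stated with \<open>x\<close> because on the zero algebra \<open>c\<close> itself
    is arbitrary.\<close>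
  have "c *\<^sub>R x = 0" for x :: 'a
  proof (cases "x = 0")
    case False
    then obtain D where D: "derivation D" "linear_trace D \<noteq> 0"
      using nonzero_traced_derivation[of x] unfolding traced_derivation_def by blast
    have "c = 0"
      by (rule einstein_derivation_traceless[OF assms(1,5,4) S c D])
    then show ?thesis
      by simp
  qed simp
  then show ?thesis
    by (simp add: ricci_flat_def c)
qed

end
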